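(* Let $G=(V,E)$ be a finite graph and let $\mathbf J=(J_e)_{e\in E}$ be ferromagnetic pair interactions on $G$ (i.e. $J_e\in[0,\infty)$ for all $e\in E$). Then for every $k\in\mathbb N$, every $j_1,\dots,j_{2k}\in V$ (not necessarily distinct) and every edge $u_0v_0\in E$, $$(-1)^{k-1}\,\frac{\partial\, u_{2k}(\sigma_{j_1},\dots,\sigma_{j_{2k}})}{\partial J_{u_0v_0}}\;\ge\;0 .$$
   Context: The Ising model on a finite graph $G=(V,E)$ with interactions $\mathbf J=(J_{uv})_{uv\in E}$, $J_{uv}\ge 0$, is the probability measure on $\{-1,+1\}^V$ given by $\mathbb P_G(\sigma)=\exp\big[\sum_{uv\in E}J_{uv}\sigma_u\sigma_v\big]/Z_G$, where $Z_G$ is the normalizing constant; $\langle\cdot\rangle_G$ denotes expectation. For vertices $j_1,\dots,j_m$ (not necessarily distinct) the Ursell function is $$u_m(\sigma_{j_1},\dots,\sigma_{j_m})=\sum_{\mathscr P}(-1)^{|\mathscr P|-1}(|\mathscr P|-1)!\prod_{P\in\mathscr P}\Big\langle\prod_{i\in P}\sigma_{j_i}\Big\rangle_G,$$ the sum being over all set partitions $\mathscr P$ of the index set $\{1,\dots,m\}$ and $|\mathscr P|$ the number of blocks; equivalently $u_m=\partial^m/\partial h_1\cdots\partial h_m\,\ln\langle\exp(\sum_i h_i\sigma_{j_i})\rangle_G\big|_{h=0}$. It is regarded as a function of $\mathbf J$. *)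

theory Defs
  imports "HOL-Analysis.Analysis" "HOL-Library.Disjoint_Sets"
begin

text \<open>Finite graph: vertex set V (finite), edge set E of 2-element subsets of V.
  Interactions J assign a real number to each edge.  Spin configurations are
  functions sigma with values in {-1,+1} on V, normalised to 1 outside V.\<close>

definition configs :: "'v set \<Rightarrow> ('v \<Rightarrow> real) set" where
  "configs V = {\<sigma>. (\<forall>v\<in>V. \<sigma> v = 1 \<or> \<sigma> v = -1) \<and> (\<forall>v. v \<notin> V \<longrightarrow> \<sigma> v = 1)}"

definition ising_weight :: "'v set set \<Rightarrow> ('v set \<Rightarrow> real) \<Rightarrow> ('v \<Rightarrow> real) \<Rightarrow> real" where
  "ising_weight E J \<sigma> = exp (\<Sum>e\<in>E. J e * (\<Prod>v\<in>e. \<sigma> v))"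

definition partition_fn :: "'v set \<Rightarrow> 'v set set \<Rightarrow> ('v set \<Rightarrow> real) \<Rightarrow> real" where
  "partition_fn V E J = (\<Sum>\<sigma>\<in>configs V. ising_weight E J \<sigma>)"

definition ising_expect ::
  "'v set \<Rightarrow> 'v set set \<Rightarrow> ('v set \<Rightarrow> real) \<Rightarrow> (('v \<Rightarrow> real) \<Rightarrow> real) \<Rightarrow> real" where
  "ising_expect V E J f = (\<Sum>\<sigma>\<in>configs V. f \<sigma> * ising_weight E J \<sigma>) / partition_fn V E J"

definition ursell ::
  "'v set \<Rightarrow> 'v set set \<Rightarrow> ('v set \<Rightarrow> real) \<Rightarrow> nat \<Rightarrow> (nat \<Rightarrow> 'v) \<Rightarrow> real" where
  "ursell V E J m j =
     (\<Sum>\<P>\<in>{\<P>. partition_on {1..m} \<P>}.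
        (-1) ^ (card \<P> - 1) * fact (card \<P> - 1) *
        (\<Prod>B\<in>\<P>. ising_expect V E J (\<lambda>\<sigma>. \<Prod>i\<in>B. \<sigma> (j i))))"

end

theory Submission
  imports Defs
begin

text \<open>
  Give each spin \<open>\<sigma>(j\<^sub>i)\<close> its own formal field \<open>h\<^sub>i\<close> with \<open>h\<^sub>i\<^sup>2 = 0\<close>; a power series in these is a
  real function on finite index sets, multiplied by subset convolution.  Make the fields purely
  imaginary, so that the sign \<open>(-1)\<^sup>k\<^sup>-\<^sup>1\<close> disappears: up to powers of i, the claim is that the
  coefficients of \<open>\<langle>\<sigma>\<^sub>v\<rangle>\<close> have one sign (these are the Ursell functions) and that so do the
  nonconstant ones of \<open>\<langle>\<sigma>\<^sub>u\<sigma>\<^sub>v\<rangle>\<close> (their derivatives with respect to \<open>J\<^sub>u\<^sub>v\<close>).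

  Take two independent copies \<open>\<sigma>, \<tau>\<close>, write \<open>exp(J\<^sub>e(\<sigma>\<^sub>e + \<tau>\<^sub>e)) = 1 + g\<^sub>e\<close> and expand over the edges.  As
  \<open>g\<^sub>e\<close> vanishes unless \<open>\<sigma>\<^sub>e = \<tau>\<^sub>e\<close>, the product \<open>\<sigma>\<tau>\<close> is constant on clusters.  In the truncated
  correlation of \<open>\<sigma>\<^sub>B\<close> with \<open>\<sigma>\<^sub>w\<close> only those clusters C of w survive on which \<open>\<tau> = -\<sigma>\<close>; they see no
  field and leave behind the squared partition function of the graph with C removed.  Hence
  the derivative of \<open>\<langle>\<sigma>\<^sub>B\<rangle>\<close> in a field at w is a combination, with weights that are
  nonnegative by Griffiths' first inequality, of \<open>\<langle>\<sigma>\<^bsub>B - C\<^esub>\<rangle>\<close> on the complement of C times the squared ratio of the two partition functions.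
  This ratio has nonnegative coefficients as well, because its derivative with respect to a field
  on C is a product of things already controlled, and removing an edge multiplies it by
  \<open>1 / (cosh J + sinh J \<langle>\<sigma>\<^sub>u\<sigma>\<^sub>v\<rangle>)\<close>.  So the three signs follow together by induction on the degree.
\<close>

section \<open>Power series modulo squares of the variables\<close>

text \<open>The value 0 on infinite sets lets finite index sets determine a series, so the ring laws
  hold over any index type.\<close>

typedef 'i mseries = "{f :: 'i set \<Rightarrow> real. \<forall>A. infinite A \<longrightarrow> f A = 0}"
  morphisms coef Abs_mseries
  by (rule exI[of _ "\<lambda>_. 0"]) simp

definition mseries :: "('i set \<Rightarrow> real) \<Rightarrow> 'i mseries" where
  "mseries f = Abs_mseries (\<lambda>A. if finite A then f A else 0)"

lemma coef_mseries [simp]: "coef (mseries f) A = (if finite A then f A else 0)"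
  unfolding mseries_def by (subst Abs_mseries_inverse) auto

lemma coef_infinite [simp]: "infinite A \<Longrightarrow> coef f A = 0"
  using coef[of f] by blast

lemma mseries_eqI: "(\<And>A. finite A \<Longrightarrow> coef f A = coef g A) \<Longrightarrow> f = g"
  by (metis coef_infinite coef_inject ext)

instantiation mseries :: (type) comm_ring_1
begin

definition zero_mseries :: "'a mseries" where "0 = mseries (\<lambda>_. 0)"
definition one_mseries :: "'a mseries" where "1 = mseries (\<lambda>A. if A = {} then 1 else 0)"
definition plus_mseries :: "'a mseries \<Rightarrow> 'a mseries \<Rightarrow> 'a mseries"
  where "f + g = mseries (\<lambda>A. coef f A + coef g A)"
definition minus_mseries :: "'a mseries \<Rightarrow> 'a mseries \<Rightarrow> 'a mseries"
  where "f - g = mseries (\<lambda>A. coef f A - coef g A)"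
definition uminus_mseries :: "'a mseries \<Rightarrow> 'a mseries"
  where "- f = mseries (\<lambda>A. - coef f A)"
definition times_mseries :: "'a mseries \<Rightarrow> 'a mseries \<Rightarrow> 'a mseries"
  where "f * g = mseries (\<lambda>A. \<Sum>S\<in>Pow A. coef f S * coef g (A - S))"

lemma coef_0 [simp]: "coef (0 :: 'a mseries) A = 0"
  by (simp add: zero_mseries_def)
lemma coef_1 [simp]: "coef (1 :: 'a mseries) A = (if A = {} then 1 else 0)"
  by (simp add: one_mseries_def)
lemma coef_add [simp]: "coef (f + g :: 'a mseries) A = coef f A + coef g A"
  by (simp add: plus_mseries_def)
lemma coef_diff [simp]: "coef (f - g :: 'a mseries) A = coef f A - coef g A"
  by (simp add: minus_mseries_def)
lemma coef_uminus [simp]: "coef (- f :: 'a mseries) A = - coef f A"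
  by (simp add: uminus_mseries_def)
lemma coef_mult:
  "finite A \<Longrightarrow> coef (f * g :: 'a mseries) A = (\<Sum>S\<in>Pow A. coef f S * coef g (A - S))"
  by (simp add: times_mseries_def)

instance
proof
  fix f g h :: "'a mseries"
  show "f * g = g * f"
  proof (rule mseries_eqI)
    fix A :: "'a set" assume A: "finite A"
    show "coef (f * g) A = coef (g * f) A"
      unfolding coef_mult[OF A]
      by (rule sum.reindex_bij_witness[of _ "\<lambda>S. A - S" "\<lambda>S. A - S"])
        (auto simp: double_diff mult.commute)
  qed
  show "f * g * h = f * (g * h)"
  proof (rule mseries_eqI)
    fix A :: "'a set" assume A: "finite A"
    have "coef (f * g * h) A
        = (\<Sum>S\<in>Pow A. \<Sum>T\<in>Pow S. coef f T * coef g (S - T) * coef h (A - S))"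
      unfolding coef_mult[OF A]
      by (intro sum.cong refl, subst coef_mult)
        (auto simp: sum_distrib_right intro: finite_subset[OF _ A])
    also have "\<dots> = (\<Sum>(S, T)\<in>Sigma (Pow A) Pow. coef f T * coef g (S - T) * coef h (A - S))"
      using A by (subst sum.Sigma) (auto intro: finite_subset)
    \<comment> \<open>With \<open>U = S - T\<close>, both bracketings become one sum over ordered
      splittings of \<open>A\<close> into three parts.\<close>
    also have "\<dots> = (\<Sum>(T, U)\<in>Sigma (Pow A) (\<lambda>T. Pow (A - T)).
        coef f T * coef g U * coef h (A - T - U))"
      by (rule sum.reindex_bij_witness[of _ "\<lambda>(T, U). (T \<union> U, T)" "\<lambda>(S, T). (T, S - T)"])
        (auto simp: Un_absorb1 Diff_Diff_Int double_diff intro!: arg_cong[where f = "coef _"])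
    also have "\<dots> = (\<Sum>T\<in>Pow A. \<Sum>U\<in>Pow (A - T). coef f T * coef g U * coef h (A - T - U))"
      using A by (subst sum.Sigma) (auto intro: finite_subset)
    also have "\<dots> = coef (f * (g * h)) A"
      unfolding coef_mult[OF A]
      by (intro sum.cong refl, subst coef_mult)
        (auto simp: sum_distrib_left mult.assoc A)
    finally show "coef (f * g * h) A = coef (f * (g * h)) A" .
  qed
  show "1 * f = f"
  proof (rule mseries_eqI)
    fix A :: "'a set" assume A: "finite A"
    have "coef (1 * f) A = (\<Sum>S\<in>Pow A. if S = {} then coef f A else 0)"
      unfolding coef_mult[OF A] by (intro sum.cong) auto
    then show "coef (1 * f) A = coef f A" using A by simp
  qed
  show "(f + g) * h = f * h + g * h"
    by (rule mseries_eqI) (simp add: coef_mult sum.distrib distrib_right)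
  show "f + g + h = f + (g + h)" "f + g = g + f" "0 + f = f" "- f + f = 0" "f - g = f + - g"
    by (rule mseries_eqI, simp)+
  show "(0 :: 'a mseries) \<noteq> 1"
    by (metis coef_0 coef_1 zero_neq_one)
qed

end

lemma coef_sum [simp]: "coef (\<Sum>x\<in>X. f x) A = (\<Sum>x\<in>X. coef (f x) A)"
  by (induction X rule: infinite_finite_induct) auto

definition mconst :: "real \<Rightarrow> 'i mseries" where
  "mconst c = mseries (\<lambda>A. if A = {} then c else 0)"

lemma coef_mconst_mult [simp]: "coef (mconst c * f) A = c * coef f A"
proof (cases "finite A")
  case True
  have "coef (mconst c * f) A = (\<Sum>S\<in>Pow A. if S = {} then c * coef f A else 0)"
    unfolding coef_mult[OF True] mconst_def by (intro sum.cong) (auto intro: True finite_subset)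
  then show ?thesis using True by simp
qed simp

lemma coef_mconst [simp]: "coef (mconst c) A = (if A = {} then c else 0)"
  by (simp add: mconst_def)

lemma coef_mult_empty [simp]: "coef (f * g) {} = coef f {} * coef g {}"
  by (simp add: coef_mult)

section \<open>Multiplicative inverses of series\<close>

function minv_coef :: "'i mseries \<Rightarrow> 'i set \<Rightarrow> real" where
  "minv_coef f A =
    (if infinite A then 0 else if A = {} then 1 / coef f {}
     else - (\<Sum>S\<in>Pow A - {A}. minv_coef f S * coef f (A - S)) / coef f {})"
  by pat_completeness auto
termination
  by (relation "Wellfounded.measure (\<lambda>(f, A). card A)") (auto intro!: psubset_card_mono)

declare minv_coef.simps [simp del]

definition minv :: "'i mseries \<Rightarrow> 'i mseries" where
  "minv f = mseries (minv_coef f)"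

lemma minv_empty [simp]: "coef (minv f) {} = 1 / coef f {}"
  by (simp add: minv_def minv_coef.simps)

text \<open>This is the coefficient at \<open>A\<close> of \<open>minv f * f = 1\<close>, solved for
  its term \<open>S = A\<close>.\<close>

lemma minv_rec:
  assumes "finite A" "A \<noteq> {}"
  shows "coef (minv f) A = - (\<Sum>S\<in>Pow A - {A}. coef (minv f) S * coef f (A - S)) / coef f {}"
proof -
  have "(\<Sum>S\<in>Pow A - {A}. minv_coef f S * coef f (A - S))
      = (\<Sum>S\<in>Pow A - {A}. coef (minv f) S * coef f (A - S))"
    using assms by (intro sum.cong refl) (auto simp: minv_def intro: finite_subset)
  then show ?thesis
    using assms by (simp add: minv_def minv_coef.simps[of f A])
qed

lemma minv_mult:
  assumes "coef f {} \<noteq> 0"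
  shows "minv f * f = 1"
proof (rule mseries_eqI)
  fix A :: "'a set" assume A: "finite A"
  show "coef (minv f * f) A = coef 1 A"
  proof (cases "A = {}")
    case False
    have "coef (minv f * f) A
        = coef (minv f) A * coef f {} + (\<Sum>S\<in>Pow A - {A}. coef (minv f) S * coef f (A - S))"
      unfolding coef_mult[OF A] using A by (subst sum.remove[of _ A]) auto
    then show ?thesis using False A assms by (simp add: minv_rec[OF A False])
  qed (use assms in simp)
qed

lemma minv_unique:
  assumes "g * f = 1"
  shows "minv f = g"
proof -
  have "coef g {} * coef f {} = 1"
    using arg_cong[OF assms, of "\<lambda>h. coef h {}"] by simp
  then have "minv f * f = 1" by (intro minv_mult) auto
  then have "minv f * (f * g) = g" by (simp flip: mult.assoc)
  then show ?thesis using assms by (simp add: mult.commute)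
qed

section \<open>Setting variables to zero; partial derivatives\<close>

definition restr :: "'i set \<Rightarrow> 'i mseries \<Rightarrow> 'i mseries" where
  "restr X f = mseries (\<lambda>A. if A \<inter> X = {} then coef f A else 0)"

lemma coef_restr [simp]: "coef (restr X f) A = (if A \<inter> X = {} then coef f A else 0)"
  by (simp add: restr_def)

text \<open>Restriction puts the variables with index in \<open>X\<close> equal to 0. An index set
  avoids \<open>X\<close> exactly when both of its parts do, so this is a ring homomorphism.\<close>

lemma restr_mult: "restr X (f * g) = restr X f * restr X g"
proof (rule mseries_eqI)
  fix A :: "'a set" assume A: "finite A"
  show "coef (restr X (f * g)) A = coef (restr X f * restr X g) A"
  proof (cases "A \<inter> X = {}")
    case True
    have "coef f S * coef g (A - S) = coef (restr X f) S * coef (restr X g) (A - S)"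
      if "S \<in> Pow A" for S
    proof -
      have "S \<inter> X = {}" "(A - S) \<inter> X = {}" using that True by auto
      then show ?thesis by simp
    qed
    then show ?thesis using A True by (simp add: coef_mult)
  next
    case False
    have "coef (restr X f) S * coef (restr X g) (A - S) = 0" if "S \<in> Pow A" for S
    proof -
      have "S \<inter> X \<noteq> {} \<or> (A - S) \<inter> X \<noteq> {}" using that False by auto
      then show ?thesis by auto
    qed
    then have "coef (restr X f * restr X g) A = 0"
      unfolding coef_mult[OF A] by (rule sum.neutral[rule_format])
    then show ?thesis using False by simp
  qed
qed

lemma restr_1 [simp]: "restr X 1 = 1"
  by (rule mseries_eqI) simp

lemma restr_diff: "restr X (f - g) = restr X f - restr X g"
  and restr_uminus: "restr X (- f) = - restr X f"
  by (rule mseries_eqI; simp)+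

definition mderiv :: "'i \<Rightarrow> 'i mseries \<Rightarrow> 'i mseries" where
  "mderiv i f = mseries (\<lambda>A. if i \<in> A then 0 else coef f (insert i A))"

lemma coef_mderiv [simp]: "coef (mderiv i f) A = (if i \<in> A then 0 else coef f (insert i A))"
  by (simp add: mderiv_def)

text \<open>Write f = f0 + h f1 and g = g0 + h g1, with h the variable of index \<open>i\<close>. As
  h^2 = 0, the coefficient of h in the product is f1 g0 + f0 g1, and f0, g0 are the
  restrictions.\<close>

lemma mderiv_mult: "mderiv i (f * g) = mderiv i f * restr {i} g + restr {i} f * mderiv i g"
proof (rule mseries_eqI)
  fix A :: "'a set" assume A: "finite A"
  show "coef (mderiv i (f * g)) A = coef (mderiv i f * restr {i} g + restr {i} f * mderiv i g) A"
  proof (cases "i \<in> A")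
    case True
    have "coef (mderiv i f * restr {i} g) A = 0" "coef (restr {i} f * mderiv i g) A = 0"
      using A True unfolding coef_mult[OF A] by (intro sum.neutral; simp)+
    then show ?thesis using True A by simp
  next
    case False
    have "(\<Sum>S\<in>Pow (insert i A). coef f S * coef g (insert i A - S))
        = (\<Sum>S\<in>Pow A. coef f S * coef g (insert i A - S))
          + (\<Sum>S\<in>insert i ` Pow A. coef f S * coef g (insert i A - S))"
      using A False by (subst Pow_insert, subst sum.union_disjoint) auto
    also have "(\<Sum>S\<in>insert i ` Pow A. coef f S * coef g (insert i A - S))
        = (\<Sum>S\<in>Pow A. coef f (insert i S) * coef g (insert i A - insert i S))"
      using False by (subst sum.reindex) (auto simp: inj_on_def)
    also have "\<dots> = (\<Sum>S\<in>Pow A. coef (mderiv i f) S * coef (restr {i} g) (A - S))"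
      using False by (intro sum.cong) auto
    also have "(\<Sum>S\<in>Pow A. coef f S * coef g (insert i A - S))
        = (\<Sum>S\<in>Pow A. coef (restr {i} f) S * coef (mderiv i g) (A - S))"
      using False by (intro sum.cong) (auto simp: insert_Diff_if)
    finally show ?thesis using A False by (simp add: coef_mult)
  qed
qed

section \<open>Series with nonnegative coefficients up to a degree\<close>

definition nonneg_upto :: "nat \<Rightarrow> 'i mseries \<Rightarrow> bool" where
  "nonneg_upto d f \<longleftrightarrow> (\<forall>A. card A \<le> d \<longrightarrow> 0 \<le> coef f A)"

lemma nonneg_upto_mult:
  assumes "nonneg_upto d f" "nonneg_upto d g"
  shows "nonneg_upto d (f * g)"
  unfolding nonneg_upto_def
proof (intro allI impI)
  fix A :: "'a set" assume d: "card A \<le> d"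
  show "0 \<le> coef (f * g) A"
  proof (cases "finite A")
    case True
    have "card S \<le> d \<and> card (A - S) \<le> d" if "S \<subseteq> A" for S
      using that True d by (meson Diff_subset card_mono le_trans)
    then show ?thesis
      using assms True by (auto simp: coef_mult nonneg_upto_def intro!: sum_nonneg mult_nonneg_nonneg)
  qed simp
qed

lemma nonneg_upto_restr: "nonneg_upto d f \<Longrightarrow> nonneg_upto d (restr X f)"
  by (simp add: nonneg_upto_def)

lemma nonneg_upto_1: "nonneg_upto d 1"
  by (simp add: nonneg_upto_def)

text \<open>If f = c - g with c > 0 and g nonnegative without constant term, the geometric series
  for 1/f is nonnegative; the recursion for \<open>minv\<close> shows this degree by degree.\<close>

lemma nonneg_upto_minv:
  assumes pos: "coef f {} > 0"
    and nonpos: "\<And>A. A \<noteq> {} \<Longrightarrow> card A \<le> d \<Longrightarrow> coef f A \<le> 0"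
  shows "nonneg_upto d (minv f)"
proof -
  have "card A \<le> d \<Longrightarrow> 0 \<le> coef (minv f) A" if "finite A" for A
    using that
  proof (induction A rule: finite_psubset_induct)
    case (psubset A)
    show ?case
    proof (cases "A = {}")
      case False
      have "coef (minv f) S * coef f (A - S) \<le> 0" if "S \<in> Pow A - {A}" for S
      proof (rule mult_nonneg_nonpos)
        have "card S \<le> d" "card (A - S) \<le> d"
          using psubset that by (meson DiffD1 Diff_subset PowD card_mono le_trans)+
        then show "0 \<le> coef (minv f) S" "coef f (A - S) \<le> 0"
          using psubset that nonpos[of "A - S"] by auto
      qed
      then have "(\<Sum>S\<in>Pow A - {A}. coef (minv f) S * coef f (A - S)) \<le> 0"
        by (rule sum_nonpos)
      then show ?thesis
        using pos psubset.hyps False by (simp add: minv_rec divide_nonpos_pos)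
    qed (use pos in simp)
  qed
  then show ?thesis
    unfolding nonneg_upto_def by (metis coef_infinite order_refl)
qed

section \<open>Spin configurations and clusters\<close>

definition spin_prod :: "'v list \<Rightarrow> ('v \<Rightarrow> real) \<Rightarrow> real" where
  "spin_prod B \<sigma> = prod_list (map \<sigma> B)"

lemma spin_prod_simps [simp]:
  "spin_prod [] \<sigma> = 1"
  "spin_prod (x # B) \<sigma> = \<sigma> x * spin_prod B \<sigma>"
  "spin_prod (A @ B) \<sigma> = spin_prod A \<sigma> * spin_prod B \<sigma>"
  by (simp_all add: spin_prod_def)

lemma spin_prod_one: "spin_prod B (\<lambda>_. 1) = 1"
  by (induction B) auto

lemma spin_prod_mult: "spin_prod B (\<lambda>x. \<sigma> x * \<tau> x) = spin_prod B \<sigma> * spin_prod B \<tau>"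
  by (induction B) (auto simp: algebra_simps)

lemma spin_prod_uminus: "spin_prod B (\<lambda>x. - \<sigma> x) = (-1) ^ length B * spin_prod B \<sigma>"
  by (induction B) auto

lemma spin_prod_cong: "(\<And>x. x \<in> set B \<Longrightarrow> \<sigma> x = \<tau> x) \<Longrightarrow> spin_prod B \<sigma> = spin_prod B \<tau>"
  by (simp add: spin_prod_def cong: map_cong)

lemma spin_prod_filter:
  "spin_prod B \<sigma> = spin_prod (filter P B) \<sigma> * spin_prod (filter (\<lambda>x. \<not> P x) B) \<sigma>"
  by (induction B) auto

lemma finite_configs: "finite V \<Longrightarrow> finite (configs V)"
  by (rule finite_subset[OF _ finite_set_of_finite_funs[of V "{1, -1}" 1]])
    (auto simp: configs_def)

lemma one_in_configs: "(\<lambda>_. 1) \<in> configs V"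
  by (simp add: configs_def)

lemma configs_mult: "\<sigma> \<in> configs V \<Longrightarrow> \<tau> \<in> configs V \<Longrightarrow> (\<lambda>x. \<sigma> x * \<tau> x) \<in> configs V"
  by (auto simp: configs_def) (metis minus_minus mult_1 mult_minus_left)

lemma configs_cases: "\<sigma> \<in> configs V \<Longrightarrow> \<sigma> x = 1 \<or> \<sigma> x = -1"
  by (auto simp: configs_def)

lemma configs_square: "\<sigma> \<in> configs V \<Longrightarrow> \<sigma> x * \<sigma> x = 1"
  using configs_cases[of \<sigma> V x] by auto

lemma spin_prod_cases: "\<sigma> \<in> configs V \<Longrightarrow> spin_prod B \<sigma> = 1 \<or> spin_prod B \<sigma> = -1"
proof (induction B)
  case (Cons x B)
  then show ?case using configs_cases[of \<sigma> V x] by auto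
qed simp

text \<open>Configurations form a group under pointwise multiplication, each element its own
  inverse, so the sum is translation invariant.\<close>

lemma sum_configs_mult:
  assumes "\<tau> \<in> configs V"
  shows "(\<Sum>\<sigma>\<in>configs V. f (\<lambda>x. \<sigma> x * \<tau> x)) = (\<Sum>\<sigma>\<in>configs V. f \<sigma>)"
  by (rule sum.reindex_bij_witness[of _ "\<lambda>\<sigma> x. \<sigma> x * \<tau> x" "\<lambda>\<sigma> x. \<sigma> x * \<tau> x"])
    (auto intro: configs_mult assms simp: mult.assoc configs_square[OF assms])

text \<open>The factors are expanded in turn: the term with \<open>p e\<close> keeps
  \<open>L\<close>, the one with \<open>q e\<close> adds the vertices of \<open>e\<close> to
  \<open>L\<close>. What remains are sums of a single spin product.\<close>

lemma griffiths_first: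
  assumes V: "finite V" and "finite \<omega>"
    and "\<And>e. e \<in> \<omega> \<Longrightarrow> e \<subseteq> V" "\<And>e. e \<in> \<omega> \<Longrightarrow> 0 \<le> p e" "\<And>e. e \<in> \<omega> \<Longrightarrow> 0 \<le> q e"
  shows "0 \<le> (\<Sum>\<sigma>\<in>configs V. spin_prod L \<sigma> * (\<Prod>e\<in>\<omega>. p e + q e * (\<Prod>x\<in>e. \<sigma> x)))"
  using assms(2-)
proof (induction \<omega> arbitrary: L rule: finite_induct)
  case empty
  show ?case
  proof (cases "\<forall>\<sigma>\<in>configs V. spin_prod L \<sigma> = 1")
    case False
    \<comment> \<open>Translating by a configuration with product -1 turns the sum into its own
      negative, so it is 0.\<close>
    then obtain \<tau> where \<tau>: "\<tau> \<in> configs V" "spin_prod L \<tau> = -1"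
      using spin_prod_cases by blast
    have "(\<Sum>\<sigma>\<in>configs V. spin_prod L \<sigma>) = - (\<Sum>\<sigma>\<in>configs V. spin_prod L \<sigma>)"
      using sum_configs_mult[OF \<tau>(1), of "spin_prod L"]
      by (simp add: spin_prod_mult \<tau>(2) sum_negf)
    then show ?thesis by simp
  qed (simp add: sum_nonneg)
next
  case (insert e \<omega>)
  have "finite e" using V insert.prems(1)[of e] by (auto intro: finite_subset)
  then obtain xs where xs: "set xs = e" "distinct xs" using finite_distinct_list by blast
  have e: "(\<Prod>x\<in>e. \<sigma> x) = spin_prod xs \<sigma>" for \<sigma> :: "'a \<Rightarrow> real"
    using xs by (metis prod.distinct_set_conv_list spin_prod_def)
  let ?P = "\<lambda>\<sigma>. \<Prod>e\<in>\<omega>. p e + q e * (\<Prod>x\<in>e. \<sigma> x)"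
  have "(\<Sum>\<sigma>\<in>configs V. spin_prod L \<sigma> * (\<Prod>e\<in>insert e \<omega>. p e + q e * (\<Prod>x\<in>e. \<sigma> x)))
      = p e * (\<Sum>\<sigma>\<in>configs V. spin_prod L \<sigma> * ?P \<sigma>)
        + q e * (\<Sum>\<sigma>\<in>configs V. spin_prod (xs @ L) \<sigma> * ?P \<sigma>)"
    using insert.hyps by (simp add: e sum_distrib_left algebra_simps flip: sum.distrib)
  also have "0 \<le> \<dots>"
    using insert.prems by (intro add_nonneg_nonneg mult_nonneg_nonneg insert.IH) auto
  finally show ?case .
qed

definition depends_on :: "'v set \<Rightarrow> (('v \<Rightarrow> real) \<Rightarrow> real) \<Rightarrow> bool" where
  "depends_on C f \<longleftrightarrow> (\<forall>\<sigma> \<tau>. (\<forall>x\<in>C. \<sigma> x = \<tau> x) \<longrightarrow> f \<sigma> = f \<tau>)"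

text \<open>Exchanging the spins on C between two independent configurations is a bijection.\<close>

lemma sum_configs_factor:
  assumes "finite V" "depends_on C a" "depends_on (- C) b"
  shows "real (card (configs V)) * (\<Sum>\<sigma>\<in>configs V. a \<sigma> * b \<sigma>)
    = (\<Sum>\<sigma>\<in>configs V. a \<sigma>) * (\<Sum>\<sigma>\<in>configs V. b \<sigma>)"
proof -
  define mix where "mix = (\<lambda>(\<sigma> :: 'a \<Rightarrow> real) \<tau> x. if x \<in> C then \<sigma> x else \<tau> x)"
  have mix: "mix \<sigma> \<tau> \<in> configs V" if "\<sigma> \<in> configs V" "\<tau> \<in> configs V" for \<sigma> \<tau>
    using that by (auto simp: mix_def configs_def)
  have ab: "a (mix \<sigma> \<tau>) = a \<sigma>" "b (mix \<sigma> \<tau>) = b \<tau>" for \<sigma> \<tau>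
    using assms by (auto simp: depends_on_def mix_def)
  have "(\<Sum>\<sigma>\<in>configs V. a \<sigma>) * (\<Sum>\<sigma>\<in>configs V. b \<sigma>)
      = (\<Sum>(\<sigma>, \<tau>)\<in>configs V \<times> configs V. a \<sigma> * b \<tau>)"
    by (simp add: sum_product sum.cartesian_product)
  also have "\<dots> = (\<Sum>(\<sigma>, \<tau>)\<in>configs V \<times> configs V. a \<sigma> * b \<sigma>)"
    by (rule sum.reindex_bij_witness[of _ "\<lambda>(\<sigma>, \<tau>). (mix \<sigma> \<tau>, mix \<tau> \<sigma>)"
        "\<lambda>(\<sigma>, \<tau>). (mix \<sigma> \<tau>, mix \<tau> \<sigma>)"])
      (auto simp: mix ab, auto simp: mix_def)
  also have "\<dots> = (\<Sum>\<tau>\<in>configs V. \<Sum>\<sigma>\<in>configs V. a \<sigma> * b \<sigma>)"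
    by (subst sum.cartesian_product[symmetric]) (simp add: sum_distrib_left)
  finally show ?thesis by simp
qed

section \<open>Clusters and the cluster expansion\<close>

definition saturated :: "'v set set \<Rightarrow> 'v set \<Rightarrow> bool" where
  "saturated \<omega> S \<longleftrightarrow> (\<forall>e\<in>\<omega>. e \<inter> S \<noteq> {} \<longrightarrow> e \<subseteq> S)"

text \<open>The connected component of w in \<open>\<omega>\<close>, described without paths.\<close>

definition cluster :: "'v set set \<Rightarrow> 'v \<Rightarrow> 'v set" where
  "cluster \<omega> w = \<Inter>{S. w \<in> S \<and> saturated \<omega> S}"

lemma cluster_least: "w \<in> S \<Longrightarrow> saturated \<omega> S \<Longrightarrow> cluster \<omega> w \<subseteq> S"
  by (auto simp: cluster_def)

lemma in_cluster: "w \<in> cluster \<omega> w"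
  by (auto simp: cluster_def)

lemma saturated_cluster: "saturated \<omega> (cluster \<omega> w)"
  unfolding saturated_def
proof (intro ballI impI)
  fix e assume e: "e \<in> \<omega>" "e \<inter> cluster \<omega> w \<noteq> {}"
  then have "e \<subseteq> S" if "w \<in> S" "saturated \<omega> S" for S
    using that cluster_least[OF that] by (auto simp: saturated_def)
  then show "e \<subseteq> cluster \<omega> w" by (auto simp: cluster_def)
qed

text \<open>For \<open>w\<close> in \<open>C\<close> and edges of size 2, these are the edge sets in
  \<open>E\<close> of connected graphs with vertex set \<open>C\<close>.\<close>

definition spanning :: "'v set set \<Rightarrow> 'v set \<Rightarrow> 'v \<Rightarrow> 'v set set set" where
  "spanning E C w = {\<omega>. \<omega> \<subseteq> E \<and> (\<forall>e\<in>\<omega>. e \<subseteq> C) \<and> cluster \<omega> w = C}"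

text \<open>Edges off the cluster do not influence it: intersecting it with the cluster of its inner
  edges gives a saturated set containing \<open>w\<close>, and minimality applies.\<close>

lemma cluster_inside: "cluster {e \<in> \<omega>. e \<subseteq> cluster \<omega> w} w = cluster \<omega> w"
proof (rule equalityI)
  let ?\<omega> = "{e \<in> \<omega>. e \<subseteq> cluster \<omega> w}"
  show "cluster ?\<omega> w \<subseteq> cluster \<omega> w"
    using saturated_cluster[of \<omega> w] in_cluster[of w \<omega>] by (intro cluster_least) (auto simp: saturated_def)
  have "saturated \<omega> (cluster \<omega> w \<inter> cluster ?\<omega> w)"
    using saturated_cluster[of \<omega> w] saturated_cluster[of ?\<omega> w] unfolding saturated_def by blast
  then have "cluster \<omega> w \<subseteq> cluster \<omega> w \<inter> cluster ?\<omega> w"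
    by (intro cluster_least) (auto simp: in_cluster)
  then show "cluster \<omega> w \<subseteq> cluster ?\<omega> w" by blast
qed

lemma cluster_Un:
  assumes "\<And>e. e \<in> \<omega>\<^sub>1 \<Longrightarrow> e \<subseteq> C" "\<And>e. e \<in> \<omega>\<^sub>2 \<Longrightarrow> e \<inter> C = {}" "cluster \<omega>\<^sub>1 w = C"
  shows "cluster (\<omega>\<^sub>1 \<union> \<omega>\<^sub>2) w = C"
proof (rule equalityI)
  show "cluster (\<omega>\<^sub>1 \<union> \<omega>\<^sub>2) w \<subseteq> C"
    using assms in_cluster[of w \<omega>\<^sub>1] by (intro cluster_least) (auto simp: saturated_def)
  have "saturated \<omega>\<^sub>1 (cluster (\<omega>\<^sub>1 \<union> \<omega>\<^sub>2) w)"
    using saturated_cluster[of "\<omega>\<^sub>1 \<union> \<omega>\<^sub>2" w] by (auto simp: saturated_def)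
  then show "C \<subseteq> cluster (\<omega>\<^sub>1 \<union> \<omega>\<^sub>2) w"
    unfolding assms(3)[symmetric] by (intro cluster_least in_cluster)
qed

text \<open>Expand over subsets of \<open>E\<close> and sort them by the cluster \<open>C\<close> of
  \<open>w\<close>. Every chosen edge lies inside \<open>C\<close> or misses it, and those missing
  \<open>C\<close> are unconstrained, so they resum to a product.\<close>

lemma cluster_expansion:
  fixes g :: "'v set \<Rightarrow> 'a :: comm_ring_1"
  assumes V: "finite V" and E: "finite E" "\<And>e. e \<in> E \<Longrightarrow> e \<subseteq> V" "{} \<notin> E" and w: "w \<in> V"
  shows "(\<Prod>e\<in>E. 1 + g e) = (\<Sum>C\<in>{C. C \<subseteq> V \<and> w \<in> C}.
    (\<Sum>\<omega>\<in>spanning E C w. prod g \<omega>) * (\<Prod>e\<in>{e \<in> E. e \<inter> C = {}}. 1 + g e))"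
proof -
  have expand: "(\<Prod>e\<in>F. 1 + g e) = (\<Sum>\<omega>\<in>Pow F. prod g \<omega>)" if "finite F" for F
    using prod_add[OF that, of g "\<lambda>_. 1"] by (simp add: add.commute)
  have clV: "cluster \<omega> w \<subseteq> V" if "\<omega> \<subseteq> E" for \<omega>
    using that E(2) w by (intro cluster_least) (auto simp: saturated_def)
  have "(\<Prod>e\<in>E. 1 + g e) = (\<Sum>\<omega>\<in>Pow E. prod g \<omega>)"
    by (rule expand) fact
  also have "\<dots> = (\<Sum>C\<in>{C. C \<subseteq> V \<and> w \<in> C}. \<Sum>\<omega>\<in>{\<omega> \<in> Pow E. cluster \<omega> w = C}. prod g \<omega>)"
  proof -
    have "finite (Pow E)" "finite {C. C \<subseteq> V \<and> w \<in> C}" using V E(1) by auto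
    moreover have "(\<lambda>\<omega>. cluster \<omega> w) ` Pow E \<subseteq> {C. C \<subseteq> V \<and> w \<in> C}"
      by (auto simp: in_cluster dest: subsetD[OF clV])
    ultimately show ?thesis by (rule sum.group[symmetric])
  qed
  also have "\<dots> = (\<Sum>C\<in>{C. C \<subseteq> V \<and> w \<in> C}.
      \<Sum>(\<omega>\<^sub>1, \<omega>\<^sub>2)\<in>spanning E C w \<times> Pow {e \<in> E. e \<inter> C = {}}. prod g \<omega>\<^sub>1 * prod g \<omega>\<^sub>2)"
  proof (rule sum.cong[OF refl])
    fix C assume C: "C \<in> {C. C \<subseteq> V \<and> w \<in> C}"
    \<comment> \<open>A nonempty edge cannot both lie in \<open>C\<close> and miss it, which makes
      the decomposition unique.\<close>
    have disj: "\<not> (e \<subseteq> C \<and> e \<inter> C = {})" if "e \<in> E" for e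
      using that E(3) by (metis Int_absorb2)
    have split: "{e \<in> \<omega>. e \<subseteq> C} \<union> {e \<in> \<omega>. e \<inter> C = {}} = \<omega>"
      "{e \<in> \<omega>. e \<subseteq> C} \<inter> {e \<in> \<omega>. e \<inter> C = {}} = {}"
      if "\<omega> \<subseteq> E" "cluster \<omega> w = C" for \<omega>
      using that saturated_cluster[of \<omega> w] disj unfolding saturated_def by blast+
    show "(\<Sum>\<omega>\<in>{\<omega> \<in> Pow E. cluster \<omega> w = C}. prod g \<omega>) =
      (\<Sum>(\<omega>\<^sub>1, \<omega>\<^sub>2)\<in>spanning E C w \<times> Pow {e \<in> E. e \<inter> C = {}}. prod g \<omega>\<^sub>1 * prod g \<omega>\<^sub>2)"
    proof (rule sum.reindex_bij_witness[of _ "\<lambda>(\<omega>\<^sub>1, \<omega>\<^sub>2). \<omega>\<^sub>1 \<union> \<omega>\<^sub>2"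
          "\<lambda>\<omega>. ({e \<in> \<omega>. e \<subseteq> C}, {e \<in> \<omega>. e \<inter> C = {}})"], goal_cases)
      case (1 \<omega>) then show ?case using split(1)[of \<omega>] by simp
    next
      case (2 \<omega>)
      then have "{e \<in> \<omega>. e \<subseteq> C} \<in> spanning E C w"
        using cluster_inside[of \<omega> w] unfolding spanning_def by force
      then show ?case using 2 by auto
    next
      case (3 p)
      then obtain \<omega>\<^sub>1 \<omega>\<^sub>2 where p: "p = (\<omega>\<^sub>1, \<omega>\<^sub>2)" "\<omega>\<^sub>1 \<subseteq> E" "\<forall>e\<in>\<omega>\<^sub>1. e \<subseteq> C"
        "\<omega>\<^sub>2 \<subseteq> {e \<in> E. e \<inter> C = {}}"
        unfolding spanning_def by blast
      have 1: "e \<subseteq> C \<and> e \<inter> C \<noteq> {}" if "e \<in> \<omega>\<^sub>1" for e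
        using disj[OF subsetD[OF p(2) that]] bspec[OF p(3) that] by simp
      have 2: "e \<inter> C = {} \<and> \<not> e \<subseteq> C" if "e \<in> \<omega>\<^sub>2" for e
        using disj[of e] subsetD[OF p(4) that] by simp
      have "{e \<in> \<omega>\<^sub>1 \<union> \<omega>\<^sub>2. e \<subseteq> C} = \<omega>\<^sub>1"
        by (rule set_eqI) (simp, metis 1 2)
      moreover have "{e \<in> \<omega>\<^sub>1 \<union> \<omega>\<^sub>2. e \<inter> C = {}} = \<omega>\<^sub>2"
        by (rule set_eqI) (simp, metis 1 2)
      ultimately show ?case using p(1) by simp
    next
      case (4 p)
      then obtain \<omega>\<^sub>1 \<omega>\<^sub>2 where p: "p = (\<omega>\<^sub>1, \<omega>\<^sub>2)" "\<omega>\<^sub>1 \<in> spanning E C w"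
        "\<omega>\<^sub>2 \<subseteq> {e \<in> E. e \<inter> C = {}}"
        by auto
      then have "cluster (\<omega>\<^sub>1 \<union> \<omega>\<^sub>2) w = C"
        by (intro cluster_Un) (use p in \<open>unfold spanning_def, blast+\<close>)
      moreover have "\<omega>\<^sub>1 \<union> \<omega>\<^sub>2 \<subseteq> E" 
      proof (rule Un_least)
        show "\<omega>\<^sub>1 \<subseteq> E" using p(2) by (simp add: spanning_def)
        show "\<omega>\<^sub>2 \<subseteq> E" by (rule subset_trans[OF p(3)]) (rule Collect_subset)
      qed
      ultimately show ?case using p(1) by simp
    next
      case (5 \<omega>)
      then have "finite \<omega>" using finite_subset[OF _ E(1)] by simp
      then have "prod g ({e \<in> \<omega>. e \<subseteq> C} \<union> {e \<in> \<omega>. e \<inter> C = {}})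
          = prod g {e \<in> \<omega>. e \<subseteq> C} * prod g {e \<in> \<omega>. e \<inter> C = {}}"
        using split[of \<omega>] 5 by (intro prod.union_disjoint) auto
      then show ?case using split[of \<omega>] 5 by simp
    qed
  qed
  also have "\<dots> = (\<Sum>C\<in>{C. C \<subseteq> V \<and> w \<in> C}.
      (\<Sum>\<omega>\<in>spanning E C w. prod g \<omega>) * (\<Prod>e\<in>{e \<in> E. e \<inter> C = {}}. 1 + g e))"
    using E(1) by (simp add: expand sum_product sum.cartesian_product)
  finally show ?thesis .
qed

section \<open>The two-replica identity\<close>

lemma configs_prod_cases: "\<sigma> \<in> configs V \<Longrightarrow> (\<Prod>x\<in>e. \<sigma> x) = 1 \<or> (\<Prod>x\<in>e. \<sigma> x) = -1"
proof (induction e rule: infinite_finite_induct)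
  case (insert x F)
  then show ?case using configs_cases[of \<sigma> V x] by auto
qed auto

definition pair_bond :: "('v set \<Rightarrow> real) \<Rightarrow> ('v \<Rightarrow> real) \<Rightarrow> ('v \<Rightarrow> real) \<Rightarrow> 'v set \<Rightarrow> real" where
  "pair_bond J \<sigma> \<tau> e = exp (J e * ((\<Prod>x\<in>e. \<sigma> x) + (\<Prod>x\<in>e. \<tau> x))) - 1"

text \<open>Removing \<open>C\<close> is modelled by switching off the couplings that touch it.
  \<open>V\<close> and \<open>E\<close> stay fixed, and the spins in \<open>C\<close> become
  free.\<close>

definition isolate :: "('v set \<Rightarrow> real) \<Rightarrow> 'v set \<Rightarrow> 'v set \<Rightarrow> real" where
  "isolate J C e = (if e \<inter> C = {} then J e else 0)"

lemma pair_weight: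
  "finite E \<Longrightarrow> ising_weight E J \<sigma> * ising_weight E J \<tau> = (\<Prod>e\<in>E. 1 + pair_bond J \<sigma> \<tau> e)"
  by (simp add: ising_weight_def pair_bond_def exp_add exp_sum distrib_left prod.distrib)

lemma pair_weight_isolate:
  assumes "finite E"
  shows "ising_weight E (isolate J C) \<sigma> * ising_weight E (isolate J C) \<tau>
    = (\<Prod>e\<in>{e \<in> E. e \<inter> C = {}}. 1 + pair_bond J \<sigma> \<tau> e)"
  unfolding pair_weight[OF assms]
  by (rule prod.mono_neutral_cong_right) (auto simp: assms pair_bond_def isolate_def)

locale ising_graph =
  fixes V :: "'v set" and E :: "'v set set" and j :: "nat \<Rightarrow> 'v"
  assumes finite_V: "finite V"
    and edges: "\<And>e. e \<in> E \<Longrightarrow> e \<subseteq> V \<and> card e = 2"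
    and j_in_V: "\<And>i. j i \<in> V"
begin

lemma finite_E: "finite E"
  using edges finite_V by (meson Pow_iff finite_Pow_iff finite_subset subsetI)

lemma edge_cases:
  assumes "e \<in> E"
  obtains x y where "e = {x, y}" "x \<noteq> y" "x \<in> V" "y \<in> V"
  using edges[OF assms] by (auto simp: card_2_iff)

text \<open>Unnormalised: \<open>B\<close> is the observable and \<open>A\<close> selects fields, so
  for fixed \<open>B\<close> these are the coefficients of a series in the fields.\<close>

definition moment :: "('v set \<Rightarrow> real) \<Rightarrow> 'v list \<Rightarrow> nat set \<Rightarrow> real" where
  "moment J B A = (\<Sum>\<sigma>\<in>configs V. spin_prod B \<sigma> * (\<Prod>i\<in>A. \<sigma> (j i)) * ising_weight E J \<sigma>)"

definition convolve :: "('v set \<Rightarrow> real) \<Rightarrow> 'v list \<Rightarrow> 'v list \<Rightarrow> nat set \<Rightarrow> real" where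
  "convolve J B B' A = (\<Sum>S\<in>Pow A. moment J B S * moment J B' (A - S))"

text \<open>The subset \<open>S\<close> chooses the replica on which each field acts, so the fields
  couple to the sum of the two replicas.\<close>

lemma convolve_eq:
  assumes "finite A"
  shows "convolve J B B' A = (\<Sum>\<sigma>\<in>configs V. \<Sum>\<tau>\<in>configs V. spin_prod B \<sigma> * spin_prod B' \<tau>
    * (\<Prod>i\<in>A. \<sigma> (j i) + \<tau> (j i)) * (ising_weight E J \<sigma> * ising_weight E J \<tau>))"
proof -
  have "convolve J B B' A = (\<Sum>S\<in>Pow A. \<Sum>\<sigma>\<in>configs V. \<Sum>\<tau>\<in>configs V.
      spin_prod B \<sigma> * spin_prod B' \<tau> * ((\<Prod>i\<in>S. \<sigma> (j i)) * (\<Prod>i\<in>A - S. \<tau> (j i)))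
      * (ising_weight E J \<sigma> * ising_weight E J \<tau>))"
    unfolding convolve_def moment_def sum_product by (simp add: mult_ac)
  also have "\<dots> = (\<Sum>\<sigma>\<in>configs V. \<Sum>\<tau>\<in>configs V. \<Sum>S\<in>Pow A.
      spin_prod B \<sigma> * spin_prod B' \<tau> * ((\<Prod>i\<in>S. \<sigma> (j i)) * (\<Prod>i\<in>A - S. \<tau> (j i)))
      * (ising_weight E J \<sigma> * ising_weight E J \<tau>))"
    by (subst sum.swap, rule sum.cong[OF refl], rule sum.swap)
  finally show ?thesis
    by (simp only: prod_add[OF assms] sum_distrib_left sum_distrib_right)
qed

text \<open>A nonzero bond forces the edge products of the replicas to agree, so the product of the
  replicas has equal values at both ends. The vertices where it has its value at \<open>w\<close>
  therefore form a saturated set.\<close>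

lemma prod_bond_nonzero:
  assumes \<omega>: "\<omega> \<in> spanning E C w" and \<sigma>: "\<sigma> \<in> configs V" and \<tau>: "\<tau> \<in> configs V"
    and nz: "(\<Prod>e\<in>\<omega>. pair_bond J \<sigma> \<tau> e) \<noteq> 0" and x: "x \<in> C"
  shows "\<sigma> x * \<tau> x = \<sigma> w * \<tau> w"
proof -
  define S where "S = {x. \<sigma> x * \<tau> x = \<sigma> w * \<tau> w}"
  have \<omega>E: "\<omega> \<subseteq> E" and C: "cluster \<omega> w = C" using \<omega> by (auto simp: spanning_def)
  have "saturated \<omega> S"
    unfolding saturated_def
  proof (intro ballI impI)
    fix e assume e: "e \<in> \<omega>" and meet: "e \<inter> S \<noteq> {}"
    obtain a b where ab: "e = {a, b}" "a \<noteq> b" by (rule edge_cases[OF subsetD[OF \<omega>E e]])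
    have "pair_bond J \<sigma> \<tau> e \<noteq> 0"
      using nz e finite_subset[OF \<omega>E finite_E] by (auto simp: prod_zero_iff)
    then have "\<sigma> a * \<sigma> b + \<tau> a * \<tau> b \<noteq> 0"
      using ab by (auto simp: pair_bond_def)
    then have "\<sigma> a * \<tau> a = \<sigma> b * \<tau> b"
      using configs_cases[OF \<sigma>, of a] configs_cases[OF \<sigma>, of b]
        configs_cases[OF \<tau>, of a] configs_cases[OF \<tau>, of b] by auto
    then show "e \<subseteq> S" using meet ab by (auto simp: S_def)
  qed
  then have "C \<subseteq> S" unfolding C[symmetric] by (intro cluster_least) (simp add: S_def)
  then show ?thesis using x by (auto simp: S_def)
qed

text \<open>The part of a cluster's contribution that involves the spins on \<open>C\<close>; the
  indicator keeps the case of opposite replicas.\<close>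

definition inner_term ::
    "('v set \<Rightarrow> real) \<Rightarrow> 'v \<Rightarrow> 'v list \<Rightarrow> 'v set \<Rightarrow> ('v \<Rightarrow> real) \<Rightarrow> ('v \<Rightarrow> real) \<Rightarrow> real" where
  "inner_term J w L C \<sigma> \<tau> = (if \<sigma> w = \<tau> w then 0 else 1) * spin_prod (w # L) \<sigma>
    * (\<Sum>\<omega>\<in>spanning E C w. \<Prod>e\<in>\<omega>. pair_bond J \<sigma> \<tau> e)"

text \<open>If the replicas agree at \<open>w\<close>, both sides vanish. Otherwise they are
  opposite on \<open>C\<close> wherever the bonds are nonzero: a field there sees a zero sum,
  \<open>\<sigma> w - \<tau> w = 2 * \<sigma> w\<close>, and each spin of \<open>B\<close> in
  \<open>C\<close> changes sign between replicas.\<close>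

lemma cluster_term:
  assumes \<sigma>: "\<sigma> \<in> configs V" and \<tau>: "\<tau> \<in> configs V" and A: "finite A"
  shows "(spin_prod B \<sigma> - spin_prod B \<tau>) * (\<sigma> w - \<tau> w) * (\<Prod>i\<in>A. \<sigma> (j i) + \<tau> (j i))
      * (\<Sum>\<omega>\<in>spanning E C w. \<Prod>e\<in>\<omega>. pair_bond J \<sigma> \<tau> e)
    = (if j ` A \<inter> C = {} then 2 * inner_term J w (filter (\<lambda>x. x \<in> C) B) C \<sigma> \<tau>
        * ((spin_prod (filter (\<lambda>x. x \<notin> C) B) \<sigma>
            - (-1) ^ length (filter (\<lambda>x. x \<in> C) B) * spin_prod (filter (\<lambda>x. x \<notin> C) B) \<tau>)
          * (\<Prod>i\<in>A. \<sigma> (j i) + \<tau> (j i))) else 0)"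
proof -
  let ?L = "filter (\<lambda>x. x \<in> C) B" and ?M = "filter (\<lambda>x. x \<notin> C) B"
  let ?PA = "\<Prod>i\<in>A. \<sigma> (j i) + \<tau> (j i)"
  let ?X = "(spin_prod B \<sigma> - spin_prod B \<tau>) * (\<sigma> w - \<tau> w) * ?PA"
  let ?Y = "if j ` A \<inter> C = {} then 2 * ((if \<sigma> w = \<tau> w then 0 else 1) * spin_prod (w # ?L) \<sigma>)
        * ((spin_prod ?M \<sigma> - (-1) ^ length ?L * spin_prod ?M \<tau>) * ?PA) else 0"
  have termwise: "?X * (\<Prod>e\<in>\<omega>. pair_bond J \<sigma> \<tau> e) = ?Y * (\<Prod>e\<in>\<omega>. pair_bond J \<sigma> \<tau> e)"
    if \<omega>: "\<omega> \<in> spanning E C w" for \<omega>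
  proof (cases "(\<Prod>e\<in>\<omega>. pair_bond J \<sigma> \<tau> e) = 0 \<or> \<sigma> w = \<tau> w")
    case False
    have "\<sigma> w * \<tau> w = -1" "\<tau> w = - \<sigma> w"
      using False configs_cases[OF \<sigma>, of w] configs_cases[OF \<tau>, of w] by auto
    then have opp: "\<tau> x = - \<sigma> x" if "x \<in> C" for x
      using prod_bond_nonzero[OF \<omega> \<sigma> \<tau> _ that] False
        configs_cases[OF \<sigma>, of x] configs_cases[OF \<tau>, of x] by auto
    show ?thesis
    proof (cases "j ` A \<inter> C = {}")
      case True
      have "spin_prod ?L \<tau> = spin_prod ?L (\<lambda>x. - \<sigma> x)"
        by (rule spin_prod_cong) (simp add: opp)
      then have "spin_prod B \<tau> = (-1) ^ length ?L * spin_prod ?L \<sigma> * spin_prod ?M \<tau>"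
        by (subst spin_prod_filter[of _ _ "\<lambda>x. x \<in> C"]) (simp add: spin_prod_uminus)
      moreover have "spin_prod B \<sigma> = spin_prod ?L \<sigma> * spin_prod ?M \<sigma>"
        by (rule spin_prod_filter)
      ultimately show ?thesis
        using True False \<open>\<tau> w = - \<sigma> w\<close> by (simp add: algebra_simps)
    next
      case False
      then obtain i where i: "i \<in> A" "j i \<in> C" by auto
      then have "\<sigma> (j i) + \<tau> (j i) = 0" using opp by simp
      then have "?PA = 0" using i(1) A by (intro prod_zero) auto
      then show ?thesis using False by simp
    qed
  qed auto
  have eq: "?X * (\<Sum>\<omega>\<in>spanning E C w. \<Prod>e\<in>\<omega>. pair_bond J \<sigma> \<tau> e)
      = ?Y * (\<Sum>\<omega>\<in>spanning E C w. \<Prod>e\<in>\<omega>. pair_bond J \<sigma> \<tau> e)"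
    unfolding sum_distrib_left by (rule sum.cong[OF refl]) (rule termwise)
  show ?thesis unfolding eq by (simp add: inner_term_def mult_ac)
qed

lemma depends_on_prod_bond:
  assumes "\<omega> \<in> spanning E C w" "\<forall>x\<in>C. \<sigma> x = \<sigma>' x \<and> \<tau> x = \<tau>' x"
  shows "(\<Prod>e\<in>\<omega>. pair_bond J \<sigma> \<tau> e) = (\<Prod>e\<in>\<omega>. pair_bond J \<sigma>' \<tau>' e)"
proof (rule prod.cong[OF refl])
  fix e assume "e \<in> \<omega>"
  then have "e \<subseteq> C" using assms(1) by (simp add: spanning_def)
  then have "(\<Prod>x\<in>e. \<sigma> x) = (\<Prod>x\<in>e. \<sigma>' x)" "(\<Prod>x\<in>e. \<tau> x) = (\<Prod>x\<in>e. \<tau>' x)"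
    using assms(2) by (auto intro!: prod.cong)
  then show "pair_bond J \<sigma> \<tau> e = pair_bond J \<sigma>' \<tau>' e" by (simp add: pair_bond_def)
qed

lemma inner_term_cong:
  assumes "w \<in> C" "set L \<subseteq> C" "\<forall>x\<in>C. \<sigma> x = \<sigma>' x \<and> \<tau> x = \<tau>' x"
  shows "inner_term J w L C \<sigma> \<tau> = inner_term J w L C \<sigma>' \<tau>'"
proof -
  have "spin_prod (w # L) \<sigma> = spin_prod (w # L) \<sigma>'"
    using assms by (intro spin_prod_cong) auto
  moreover have "\<sigma> w = \<sigma>' w" "\<tau> w = \<tau>' w" using assms by auto
  moreover have "(\<Sum>\<omega>\<in>spanning E C w. \<Prod>e\<in>\<omega>. pair_bond J \<sigma> \<tau> e)
      = (\<Sum>\<omega>\<in>spanning E C w. \<Prod>e\<in>\<omega>. pair_bond J \<sigma>' \<tau>' e)"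
    using assms(3) by (intro sum.cong refl depends_on_prod_bond) auto
  ultimately show ?thesis unfolding inner_term_def by simp
qed

lemma ising_weight_isolate_cong:
  assumes "\<forall>x\<in>-C. \<sigma> x = \<tau> x"
  shows "ising_weight E (isolate J C) \<sigma> = ising_weight E (isolate J C) \<tau>"
proof -
  have "isolate J C e * (\<Prod>x\<in>e. \<sigma> x) = isolate J C e * (\<Prod>x\<in>e. \<tau> x)" for e
  proof (cases "e \<inter> C = {}")
    case True
    then have "(\<Prod>x\<in>e. \<sigma> x) = (\<Prod>x\<in>e. \<tau> x)" using assms by (intro prod.cong) auto
    then show ?thesis by simp
  qed (simp add: isolate_def)
  then have "(\<Sum>e\<in>E. isolate J C e * (\<Prod>x\<in>e. \<sigma> x)) = (\<Sum>e\<in>E. isolate J C e * (\<Prod>x\<in>e. \<tau> x))"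
    by (intro sum.cong refl)
  then show ?thesis by (simp add: ising_weight_def)
qed

text \<open>\<open>sum_configs_factor\<close> is applied once per replica, hence the square.\<close>

lemma sum_pair_factor:
  assumes a: "\<And>\<sigma> \<sigma>' \<tau> \<tau>'. \<forall>x\<in>C. \<sigma> x = \<sigma>' x \<and> \<tau> x = \<tau>' x \<Longrightarrow> a \<sigma> \<tau> = a \<sigma>' \<tau>'"
    and b: "\<And>\<sigma> \<sigma>' \<tau> \<tau>'. \<forall>x\<in>-C. \<sigma> x = \<sigma>' x \<and> \<tau> x = \<tau>' x \<Longrightarrow> b \<sigma> \<tau> = b \<sigma>' \<tau>'"
  shows "real (card (configs V)) ^ 2 * (\<Sum>\<sigma>\<in>configs V. \<Sum>\<tau>\<in>configs V. a \<sigma> \<tau> * b \<sigma> \<tau>)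
    = (\<Sum>\<sigma>\<in>configs V. \<Sum>\<tau>\<in>configs V. a \<sigma> \<tau>) * (\<Sum>\<sigma>\<in>configs V. \<Sum>\<tau>\<in>configs V. b \<sigma> \<tau>)"
proof -
  let ?N = "real (card (configs V))"
  have inner: "?N * (\<Sum>\<tau>\<in>configs V. a \<sigma> \<tau> * b \<sigma> \<tau>)
      = (\<Sum>\<tau>\<in>configs V. a \<sigma> \<tau>) * (\<Sum>\<tau>\<in>configs V. b \<sigma> \<tau>)" for \<sigma>
  proof (rule sum_configs_factor[OF finite_V])
    show "depends_on C (a \<sigma>)" "depends_on (- C) (b \<sigma>)"
      unfolding depends_on_def by (intro allI impI a b; simp)+
  qed
  have outer: "?N * (\<Sum>\<sigma>\<in>configs V. (\<Sum>\<tau>\<in>configs V. a \<sigma> \<tau>) * (\<Sum>\<tau>\<in>configs V. b \<sigma> \<tau>))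
      = (\<Sum>\<sigma>\<in>configs V. \<Sum>\<tau>\<in>configs V. a \<sigma> \<tau>) * (\<Sum>\<sigma>\<in>configs V. \<Sum>\<tau>\<in>configs V. b \<sigma> \<tau>)"
  proof (rule sum_configs_factor[OF finite_V])
    show "depends_on C (\<lambda>\<sigma>. \<Sum>\<tau>\<in>configs V. a \<sigma> \<tau>)"
      "depends_on (- C) (\<lambda>\<sigma>. \<Sum>\<tau>\<in>configs V. b \<sigma> \<tau>)"
      unfolding depends_on_def by (intro allI impI sum.cong refl a b; simp)+
  qed
  have "?N ^ 2 * (\<Sum>\<sigma>\<in>configs V. \<Sum>\<tau>\<in>configs V. a \<sigma> \<tau> * b \<sigma> \<tau>)
      = ?N * (\<Sum>\<sigma>\<in>configs V. ?N * (\<Sum>\<tau>\<in>configs V. a \<sigma> \<tau> * b \<sigma> \<tau>))"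
    by (simp add: power2_eq_square sum_distrib_left mult.assoc)
  then show ?thesis by (simp only: inner outer)
qed

text \<open>Put \<open>\<tau> = \<rho> * \<sigma>\<close> pointwise. For fixed \<open>\<rho>\<close>
  a bond is either 0 or cosh(2J) - 1 plus sinh(2J) times the edge product of
  \<open>\<sigma>\<close>, so Griffiths' first inequality applies to the sum over
  \<open>\<sigma>\<close>.\<close>

lemma sum_inner_term_nonneg:
  assumes J: "\<And>e. e \<in> E \<Longrightarrow> 0 \<le> J e"
  shows "0 \<le> (\<Sum>\<sigma>\<in>configs V. \<Sum>\<tau>\<in>configs V. inner_term J w L C \<sigma> \<tau>)"
proof -
  define p where "p \<rho> e = (if (\<Prod>x\<in>e. \<rho> x) = 1 then cosh (2 * J e) - 1 else 0)"
    for \<rho> :: "'v \<Rightarrow> real" and e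
  define q where "q \<rho> e = (if (\<Prod>x\<in>e. \<rho> x) = 1 then sinh (2 * J e) else 0)"
    for \<rho> :: "'v \<Rightarrow> real" and e
  have bond: "pair_bond J \<sigma> (\<lambda>x. \<rho> x * \<sigma> x) e = p \<rho> e + q \<rho> e * (\<Prod>x\<in>e. \<sigma> x)"
    if "\<sigma> \<in> configs V" "\<rho> \<in> configs V" for \<sigma> \<rho> e
    using configs_prod_cases[OF that(1), of e] configs_prod_cases[OF that(2), of e]
    by (auto simp: pair_bond_def p_def q_def prod.distrib cosh_def sinh_def field_simps)
  have "(\<Sum>\<sigma>\<in>configs V. \<Sum>\<tau>\<in>configs V. inner_term J w L C \<sigma> \<tau>)
      = (\<Sum>\<sigma>\<in>configs V. \<Sum>\<rho>\<in>configs V. inner_term J w L C \<sigma> (\<lambda>x. \<rho> x * \<sigma> x))"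
    by (intro sum.cong refl sum_configs_mult[symmetric])
  also have "\<dots> = (\<Sum>\<sigma>\<in>configs V. \<Sum>\<rho>\<in>configs V. \<Sum>\<omega>\<in>spanning E C w.
      (if \<rho> w = 1 then 0 else 1) *
        (spin_prod (w # L) \<sigma> * (\<Prod>e\<in>\<omega>. p \<rho> e + q \<rho> e * (\<Prod>x\<in>e. \<sigma> x))))"
  proof (intro sum.cong refl)
    fix \<sigma> \<rho> assume c: "\<sigma> \<in> configs V" "\<rho> \<in> configs V"
    have "(\<sigma> w = \<rho> w * \<sigma> w) = (\<rho> w = 1)"
      using configs_cases[OF c(1), of w] by auto
    then show "inner_term J w L C \<sigma> (\<lambda>x. \<rho> x * \<sigma> x) = (\<Sum>\<omega>\<in>spanning E C w.
      (if \<rho> w = 1 then 0 else 1) *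
        (spin_prod (w # L) \<sigma> * (\<Prod>e\<in>\<omega>. p \<rho> e + q \<rho> e * (\<Prod>x\<in>e. \<sigma> x))))"
      unfolding inner_term_def bond[OF c] sum_distrib_left by (simp add: mult_ac)
  qed
  also have "\<dots> = (\<Sum>\<rho>\<in>configs V. \<Sum>\<omega>\<in>spanning E C w. (if \<rho> w = 1 then 0 else 1) *
      (\<Sum>\<sigma>\<in>configs V. spin_prod (w # L) \<sigma> * (\<Prod>e\<in>\<omega>. p \<rho> e + q \<rho> e * (\<Prod>x\<in>e. \<sigma> x))))"
    by (subst sum.swap, rule sum.cong[OF refl], subst sum.swap) (simp add: sum_distrib_left)
  also have "0 \<le> \<dots>"
  proof (rule sum_nonneg, rule sum_nonneg, rule mult_nonneg_nonneg)
    fix \<rho> \<omega> assume "\<rho> \<in> configs V" and "\<omega> \<in> spanning E C w"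
    then have \<omega>: "\<omega> \<subseteq> E" by (simp add: spanning_def)
    show "0 \<le> (\<Sum>\<sigma>\<in>configs V. spin_prod (w # L) \<sigma> * (\<Prod>e\<in>\<omega>. p \<rho> e + q \<rho> e * (\<Prod>x\<in>e. \<sigma> x)))"
      using \<omega> J edges finite_V finite_subset[OF \<omega> finite_E]
      by (intro griffiths_first) (auto simp: p_def q_def cosh_real_ge_1)
  qed simp
  finally show ?thesis .
qed

text \<open>Flipping all spins of both replicas preserves the bonds and negates the odd product over
  \<open>w # L\<close>.\<close>

lemma sum_inner_term_even:
  assumes w: "w \<in> V" and L: "set L \<subseteq> V" "even (length L)"
  shows "(\<Sum>\<sigma>\<in>configs V. \<Sum>\<tau>\<in>configs V. inner_term J w L C \<sigma> \<tau>) = 0"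
proof -
  define \<nu> :: "'v \<Rightarrow> real" where "\<nu> x = (if x \<in> V then -1 else 1)" for x
  have \<nu>: "\<nu> \<in> configs V" by (simp add: \<nu>_def configs_def)
  have spin: "spin_prod (w # L) \<nu> = -1"
  proof -
    have "spin_prod (w # L) \<nu> = spin_prod (w # L) (\<lambda>_. - 1)"
      using w L by (intro spin_prod_cong) (auto simp: \<nu>_def)
    also have "\<dots> = (-1) ^ length (w # L)" by (subst spin_prod_uminus) (simp add: spin_prod_one)
    finally show ?thesis using L(2) by simp
  qed
  have flip: "inner_term J w L C (\<lambda>x. \<sigma> x * \<nu> x) (\<lambda>x. \<tau> x * \<nu> x) = - inner_term J w L C \<sigma> \<tau>" for \<sigma> \<tau>
  proof -
    have "pair_bond J (\<lambda>x. \<sigma> x * \<nu> x) (\<lambda>x. \<tau> x * \<nu> x) e = pair_bond J \<sigma> \<tau> e" if "e \<in> E" for e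
      by (rule edge_cases[OF that]) (auto simp: pair_bond_def \<nu>_def)
    then have "(\<Sum>\<omega>\<in>spanning E C w. \<Prod>e\<in>\<omega>. pair_bond J (\<lambda>x. \<sigma> x * \<nu> x) (\<lambda>x. \<tau> x * \<nu> x) e)
        = (\<Sum>\<omega>\<in>spanning E C w. \<Prod>e\<in>\<omega>. pair_bond J \<sigma> \<tau> e)"
      by (intro sum.cong refl prod.cong) (auto simp: spanning_def)
    moreover have "(\<sigma> w * \<nu> w = \<tau> w * \<nu> w) = (\<sigma> w = \<tau> w)" by (simp add: \<nu>_def)
    ultimately show ?thesis
      unfolding inner_term_def spin_prod_mult spin by simp
  qed
  have "(\<Sum>\<sigma>\<in>configs V. \<Sum>\<tau>\<in>configs V. inner_term J w L C \<sigma> \<tau>)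
      = (\<Sum>\<sigma>\<in>configs V. \<Sum>\<tau>\<in>configs V. inner_term J w L C (\<lambda>x. \<sigma> x * \<nu> x) (\<lambda>x. \<tau> x * \<nu> x))"
    using sum_configs_mult[OF \<nu>, of "\<lambda>\<sigma>. \<Sum>\<tau>\<in>configs V. inner_term J w L C \<sigma> \<tau>"]
    by (simp add: sum_configs_mult[OF \<nu>, of "inner_term J w L C _"])
  then show ?thesis by (simp add: flip sum_negf)
qed

text \<open>The 2 comes from \<open>\<sigma> w - \<tau> w = 2 * \<sigma> w\<close>, the denominator
  from factoring the pair sum into spins on and off \<open>C\<close>.\<close>

definition cluster_weight :: "('v set \<Rightarrow> real) \<Rightarrow> 'v \<Rightarrow> 'v list \<Rightarrow> 'v set \<Rightarrow> real" where
  "cluster_weight J w B C =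
    2 * (\<Sum>\<sigma>\<in>configs V. \<Sum>\<tau>\<in>configs V. inner_term J w (filter (\<lambda>x. x \<in> C) B) C \<sigma> \<tau>)
      / real (card (configs V)) ^ 2"

lemma cluster_weight_nonneg: "(\<And>e. e \<in> E \<Longrightarrow> 0 \<le> J e) \<Longrightarrow> 0 \<le> cluster_weight J w B C"
  unfolding cluster_weight_def
  by (intro divide_nonneg_nonneg mult_nonneg_nonneg sum_inner_term_nonneg) auto

lemma cluster_weight_even:
  "w \<in> V \<Longrightarrow> set B \<subseteq> V \<Longrightarrow> even (length (filter (\<lambda>x. x \<in> C) B)) \<Longrightarrow> cluster_weight J w B C = 0"
  unfolding cluster_weight_def by (subst sum_inner_term_even) auto

lemma sum_cluster_term:
  assumes w: "w \<in> V" "w \<in> C" and B: "set B \<subseteq> V" and A: "finite A" "j ` A \<inter> C = {}"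
  shows "(\<Sum>\<sigma>\<in>configs V. \<Sum>\<tau>\<in>configs V. 2 * inner_term J w (filter (\<lambda>x. x \<in> C) B) C \<sigma> \<tau>
        * ((spin_prod (filter (\<lambda>x. x \<notin> C) B) \<sigma>
            - (-1) ^ length (filter (\<lambda>x. x \<in> C) B) * spin_prod (filter (\<lambda>x. x \<notin> C) B) \<tau>)
          * (\<Prod>i\<in>A. \<sigma> (j i) + \<tau> (j i)))
        * (ising_weight E (isolate J C) \<sigma> * ising_weight E (isolate J C) \<tau>))
    = 2 * (cluster_weight J w B C * convolve (isolate J C) (filter (\<lambda>x. x \<notin> C) B) [] A)"
proof -
  let ?L = "filter (\<lambda>x. x \<in> C) B" and ?M = "filter (\<lambda>x. x \<notin> C) B"
  let ?N = "real (card (configs V))" and ?W = "ising_weight E (isolate J C)"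
  define b where "b \<sigma> \<tau> = (spin_prod ?M \<sigma> - (-1) ^ length ?L * spin_prod ?M \<tau>)
    * (\<Prod>i\<in>A. \<sigma> (j i) + \<tau> (j i)) * (?W \<sigma> * ?W \<tau>)" for \<sigma> \<tau>
  have N: "?N \<noteq> 0"
    using one_in_configs[of V] finite_configs[OF finite_V] by (auto simp: card_eq_0_iff)
  have b_cong: "b \<sigma> \<tau> = b \<sigma>' \<tau>'" if eq: "\<forall>x\<in>-C. \<sigma> x = \<sigma>' x \<and> \<tau> x = \<tau>' x" for \<sigma> \<tau> \<sigma>' \<tau>'
  proof -
    have "?W \<sigma> = ?W \<sigma>'" "?W \<tau> = ?W \<tau>'" using eq by (auto intro!: ising_weight_isolate_cong)
    moreover have "spin_prod ?M \<sigma> = spin_prod ?M \<sigma>'" "spin_prod ?M \<tau> = spin_prod ?M \<tau>'"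
      using eq by (auto intro!: spin_prod_cong)
    moreover have "(\<Prod>i\<in>A. \<sigma> (j i) + \<tau> (j i)) = (\<Prod>i\<in>A. \<sigma>' (j i) + \<tau>' (j i))"
      using A(2) eq by (intro prod.cong refl) (simp add: disjoint_iff)
    ultimately show ?thesis by (simp add: b_def)
  qed
  let ?a = "\<Sum>\<sigma>\<in>configs V. \<Sum>\<tau>\<in>configs V. inner_term J w ?L C \<sigma> \<tau>"
  let ?b = "\<Sum>\<sigma>\<in>configs V. \<Sum>\<tau>\<in>configs V. b \<sigma> \<tau>"
  have "?N ^ 2 * (\<Sum>\<sigma>\<in>configs V. \<Sum>\<tau>\<in>configs V. inner_term J w ?L C \<sigma> \<tau> * b \<sigma> \<tau>) = ?a * ?b"
  proof (rule sum_pair_factor[of C])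
    show "inner_term J w ?L C \<sigma> \<tau> = inner_term J w ?L C \<sigma>' \<tau>'"
      if "\<forall>x\<in>C. \<sigma> x = \<sigma>' x \<and> \<tau> x = \<tau>' x" for \<sigma> \<tau> \<sigma>' \<tau>'
      using w that by (intro inner_term_cong) auto
  qed (rule b_cong)
  then have "2 * (\<Sum>\<sigma>\<in>configs V. \<Sum>\<tau>\<in>configs V. inner_term J w ?L C \<sigma> \<tau> * b \<sigma> \<tau>)
      = cluster_weight J w B C * ?b"
    using N by (simp add: cluster_weight_def field_simps)
  \<comment> \<open>For an odd number of spins of \<open>B\<close> in \<open>C\<close> the two terms
    of \<open>b\<close> are added, and exchanging the replicas shows them equal in sum. For an even
    number the weight is 0.\<close>
  also have "cluster_weight J w B C * ?b
      = cluster_weight J w B C * (2 * convolve (isolate J C) ?M [] A)"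
  proof (cases "even (length ?L)")
    case True
    then show ?thesis using cluster_weight_even[OF w(1) B] by simp
  next
    case False
    have "?b = (\<Sum>\<sigma>\<in>configs V. \<Sum>\<tau>\<in>configs V.
        spin_prod ?M \<sigma> * (\<Prod>i\<in>A. \<sigma> (j i) + \<tau> (j i)) * (?W \<sigma> * ?W \<tau>))
      + (\<Sum>\<sigma>\<in>configs V. \<Sum>\<tau>\<in>configs V.
        spin_prod ?M \<tau> * (\<Prod>i\<in>A. \<sigma> (j i) + \<tau> (j i)) * (?W \<sigma> * ?W \<tau>))"
      using False by (simp add: b_def distrib_right sum.distrib)
    also have "(\<Sum>\<sigma>\<in>configs V. \<Sum>\<tau>\<in>configs V.
        spin_prod ?M \<tau> * (\<Prod>i\<in>A. \<sigma> (j i) + \<tau> (j i)) * (?W \<sigma> * ?W \<tau>))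
      = (\<Sum>\<sigma>\<in>configs V. \<Sum>\<tau>\<in>configs V.
        spin_prod ?M \<sigma> * (\<Prod>i\<in>A. \<sigma> (j i) + \<tau> (j i)) * (?W \<sigma> * ?W \<tau>))"
      by (subst sum.swap) (simp add: add.commute mult.commute mult.left_commute)
    finally show ?thesis by (simp add: convolve_eq[OF A(1)])
  qed
  finally show ?thesis
    by (simp add: b_def sum_distrib_left mult_ac)
qed

text \<open>Symmetrising in the replicas turns the truncated correlation into the difference of
  \<open>spin_prod B\<close> times the difference of the spins at \<open>w\<close>. Each cluster of
  \<open>w\<close> then contributes a weight times a quantity of the system with that cluster
  removed.\<close>

theorem two_replica_identity:
  assumes w: "w \<in> V" and B: "set B \<subseteq> V" and A: "finite A"
  shows "convolve J (w # B) [] A - convolve J B [w] A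
    = (\<Sum>C\<in>{C. C \<subseteq> V \<and> w \<in> C}. cluster_weight J w B C
        * (if j ` A \<inter> C = {} then convolve (isolate J C) (filter (\<lambda>x. x \<notin> C) B) [] A else 0))"
proof -
  let ?Cs = "{C. C \<subseteq> V \<and> w \<in> C}"
  let ?PA = "\<lambda>(\<sigma> :: 'v \<Rightarrow> real) \<tau>. \<Prod>i\<in>A. \<sigma> (j i) + \<tau> (j i)"
  let ?W = "\<lambda>J \<sigma> \<tau>. ising_weight E J \<sigma> * ising_weight E J \<tau>"
  let ?O = "\<lambda>\<sigma> \<tau>. (spin_prod B \<sigma> - spin_prod B \<tau>) * (\<sigma> w - \<tau> w)"
  let ?D = "\<lambda>\<sigma> \<tau>. (\<sigma> w * spin_prod B \<sigma> - spin_prod B \<sigma> * \<tau> w) * ?PA \<sigma> \<tau> * ?W J \<sigma> \<tau>"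
  have E0: "{} \<notin> E" using edges[of "{}"] by auto
  have expand: "?W J \<sigma> \<tau> = (\<Sum>C\<in>?Cs. (\<Sum>\<omega>\<in>spanning E C w. \<Prod>e\<in>\<omega>. pair_bond J \<sigma> \<tau> e)
      * ?W (isolate J C) \<sigma> \<tau>)" for \<sigma> \<tau>
    unfolding pair_weight_isolate[OF finite_E] unfolding pair_weight[OF finite_E]
    using edges E0 w by (intro cluster_expansion[OF finite_V finite_E]) auto
  have diff: "convolve J (w # B) [] A - convolve J B [w] A
      = (\<Sum>\<sigma>\<in>configs V. \<Sum>\<tau>\<in>configs V. ?D \<sigma> \<tau>)"
    unfolding convolve_eq[OF A] by (simp add: left_diff_distrib sum_subtractf)
  have "2 * (convolve J (w # B) [] A - convolve J B [w] A)
      = (\<Sum>\<sigma>\<in>configs V. \<Sum>\<tau>\<in>configs V. ?D \<sigma> \<tau>) + (\<Sum>\<sigma>\<in>configs V. \<Sum>\<tau>\<in>configs V. ?D \<tau> \<sigma>)"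
    unfolding diff by (subst (3) sum.swap) simp
  also have "\<dots> = (\<Sum>\<sigma>\<in>configs V. \<Sum>\<tau>\<in>configs V. ?O \<sigma> \<tau> * ?PA \<sigma> \<tau> * ?W J \<sigma> \<tau>)"
  proof -
    have "?PA \<tau> \<sigma> = ?PA \<sigma> \<tau>" for \<sigma> \<tau>
      by (rule prod.cong[OF refl], rule add.commute)
    then show ?thesis by (simp add: algebra_simps flip: sum.distrib)
  qed
  also have "\<dots> = (\<Sum>\<sigma>\<in>configs V. \<Sum>\<tau>\<in>configs V. \<Sum>C\<in>?Cs. (?O \<sigma> \<tau> * ?PA \<sigma> \<tau>
      * (\<Sum>\<omega>\<in>spanning E C w. \<Prod>e\<in>\<omega>. pair_bond J \<sigma> \<tau> e)) * ?W (isolate J C) \<sigma> \<tau>)"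
    by (simp only: expand sum_distrib_left[where A = ?Cs] mult.assoc)
  also have "\<dots> = (\<Sum>C\<in>?Cs. \<Sum>\<sigma>\<in>configs V. \<Sum>\<tau>\<in>configs V. (?O \<sigma> \<tau> * ?PA \<sigma> \<tau>
      * (\<Sum>\<omega>\<in>spanning E C w. \<Prod>e\<in>\<omega>. pair_bond J \<sigma> \<tau> e)) * ?W (isolate J C) \<sigma> \<tau>)"
    by (simp only: sum.swap[where B = ?Cs])
  also have "\<dots> = (\<Sum>C\<in>?Cs. 2 * (cluster_weight J w B C
        * (if j ` A \<inter> C = {} then convolve (isolate J C) (filter (\<lambda>x. x \<notin> C) B) [] A else 0)))"
  proof (rule sum.cong[OF refl])
    fix C assume C: "C \<in> ?Cs"
    show "(\<Sum>\<sigma>\<in>configs V. \<Sum>\<tau>\<in>configs V. (?O \<sigma> \<tau> * ?PA \<sigma> \<tau>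
        * (\<Sum>\<omega>\<in>spanning E C w. \<Prod>e\<in>\<omega>. pair_bond J \<sigma> \<tau> e)) * ?W (isolate J C) \<sigma> \<tau>)
      = 2 * (cluster_weight J w B C
        * (if j ` A \<inter> C = {} then convolve (isolate J C) (filter (\<lambda>x. x \<notin> C) B) [] A else 0))"
    proof (cases "j ` A \<inter> C = {}")
      case True
      then show ?thesis
        using C by (simp add: cluster_term[OF _ _ A] sum_cluster_term[OF w _ B A, symmetric])
    next
      case False
      then show ?thesis by (simp add: cluster_term[OF _ _ A])
    qed
  qed
  finally show ?thesis by (simp flip: sum_distrib_left)
qed

end

section \<open>Signs in an imaginary field\<close>

context ising_graph
begin

text \<open>A global spin flip keeps the weight and negates an odd product.\<close>

lemma moment_odd:
  assumes B: "set B \<subseteq> V" and odd: "odd (card A + length B)"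
  shows "moment J B A = 0"
proof -
  define \<nu> :: "'v \<Rightarrow> real" where "\<nu> x = (if x \<in> V then -1 else 1)" for x
  have \<nu>: "\<nu> \<in> configs V" by (simp add: \<nu>_def configs_def)
  have "spin_prod B \<nu> = spin_prod B (\<lambda>_. - 1)"
    using B by (intro spin_prod_cong) (auto simp: \<nu>_def)
  also have "\<dots> = (-1) ^ length B" by (subst spin_prod_uminus) (simp add: spin_prod_one)
  finally have spin: "spin_prod B \<nu> = (-1) ^ length B" .
  have field: "(\<Prod>i\<in>A. \<nu> (j i)) = (-1) ^ card A"
    using j_in_V by (simp add: \<nu>_def)
  have weight: "ising_weight E J (\<lambda>x. \<sigma> x * \<nu> x) = ising_weight E J \<sigma>" for \<sigma>
  proof -
    have "(\<Prod>x\<in>e. \<sigma> x * \<nu> x) = (\<Prod>x\<in>e. \<sigma> x)" if "e \<in> E" for e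
      by (rule edge_cases[OF that]) (simp add: \<nu>_def)
    then show ?thesis by (simp add: ising_weight_def)
  qed
  have sign: "(-1 :: real) ^ length B * (-1) ^ card A = -1"
    using odd by (simp add: add.commute flip: power_add)
  have "moment J B A = (\<Sum>\<sigma>\<in>configs V. ((-1) ^ length B * (-1) ^ card A)
      * (spin_prod B \<sigma> * (\<Prod>i\<in>A. \<sigma> (j i)) * ising_weight E J \<sigma>))"
    unfolding moment_def
    by (subst sum_configs_mult[OF \<nu>, symmetric])
      (simp add: spin_prod_mult prod.distrib spin field weight mult_ac)
  then have "moment J B A = - moment J B A"
    unfolding sign by (simp add: moment_def sum_negf)
  then show ?thesis by simp
qed

text \<open>The sign stands for a factor i at every spin: \<open>moment_odd\<close> makes the exponent an integer
  whenever it matters, so the signs are multiplicative.\<close>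

definition mom :: "('v set \<Rightarrow> real) \<Rightarrow> 'v list \<Rightarrow> nat mseries" where
  "mom J B = mseries (\<lambda>A. (-1) ^ ((card A + length B) div 2) * moment J B A)"

lemma coef_mom: "finite A \<Longrightarrow> coef (mom J B) A = (-1) ^ ((card A + length B) div 2) * moment J B A"
  by (simp add: mom_def)

lemma moment_pos: "moment J [] {} > 0"
  unfolding moment_def using finite_configs[OF finite_V] one_in_configs[of V]
  by (intro sum_pos) (auto simp: ising_weight_def)

lemma mom_pos: "coef (mom J []) {} > 0"
  using moment_pos by (simp add: coef_mom)

text \<open>Either both spin counts are even and their halves add exactly, or one moment vanishes by
  \<open>moment_odd\<close>.\<close>

lemma coef_mom_mult:
  assumes A: "finite A" and B: "set B \<subseteq> V" "set B' \<subseteq> V"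
  shows "coef (mom J B * mom J B') A
    = (-1) ^ ((card A + length B + length B') div 2) * convolve J B B' A"
proof -
  have "coef (mom J B) S * coef (mom J B') (A - S)
      = (-1) ^ ((card A + length B + length B') div 2) * (moment J B S * moment J B' (A - S))"
    if S: "S \<in> Pow A" for S
  proof (cases "even (card S + length B) \<and> even (card (A - S) + length B')")
    case True
    have fin: "finite S" "finite (A - S)" using S A finite_subset by auto
    have card: "card A = card S + card (A - S)"
      using S A card_Diff_subset[OF fin(1), of A] card_mono[of A S] by simp
    obtain a b where ab: "card S + length B = 2 * a" "card (A - S) + length B' = 2 * b"
      using True by (metis evenE)
    have "card A + length B + length B' = 2 * (a + b)" using ab card by simp
    then have "(card A + length B + length B') div 2 = a + b" by simp
    then show ?thesis using fin ab by (simp add: coef_mom power_add)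
  next
    case False
    then have "moment J B S = 0 \<or> moment J B' (A - S) = 0"
      using moment_odd[OF B(1)] moment_odd[OF B(2)] by blast
    then show ?thesis using S A by (auto simp: coef_mom finite_subset)
  qed
  then show ?thesis unfolding coef_mult[OF A] convolve_def by (simp add: sum_distrib_left)
qed

lemma moment_insert:
  "finite A \<Longrightarrow> i \<notin> A \<Longrightarrow> moment J B (insert i A) = moment J (j i # B) A"
  by (simp add: moment_def mult_ac)

text \<open>A field derivative brings down a spin. As \<open>i\<close> moves from the index set to
  the list, the spin count, and so the sign, is unchanged.\<close>

lemma mderiv_mom: "mderiv i (mom J B) = restr {i} (mom J (j i # B))"
  by (rule mseries_eqI) (simp add: coef_mom moment_insert)

section \<open>Normalised correlations and ratios of partition functions\<close>

definition corr :: "('v set \<Rightarrow> real) \<Rightarrow> 'v list \<Rightarrow> nat mseries" where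
  "corr J B = mom J B * minv (mom J [])"

lemma minv_mom: "minv (mom J []) * mom J [] = 1"
  using mom_pos[of J] by (intro minv_mult) simp

lemma corr_mult: "corr J B * mom J [] = mom J B"
  by (simp add: corr_def mult.assoc minv_mom)

lemma corr_Nil [simp]: "corr J [] = 1"
  using minv_mom[of J] by (simp add: corr_def mult.commute)

definition sites :: "'v set \<Rightarrow> nat set" where
  "sites C = {i. j i \<in> C}"

text \<open>The ratio of the partition functions after and before cutting off \<open>C\<close>
  together with its fields; the two replicas produce its square.\<close>

definition vac :: "('v set \<Rightarrow> real) \<Rightarrow> 'v set \<Rightarrow> nat mseries" where
  "vac J C = restr (sites C) (mom (isolate J C) []) * minv (mom J [])"

lemma vac_mult: "vac J C * mom J [] = restr (sites C) (mom (isolate J C) [])"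
  by (simp add: vac_def mult.assoc minv_mom)

lemma length_filter_split:
  "length B = length (filter (\<lambda>x. x \<in> C) B) + length (filter (\<lambda>x. x \<notin> C) B)"
  by (induction B) auto

text \<open>A contributing cluster contains exactly one entry of \<open>B\<close>. Together with
  \<open>w\<close> it removes two spins, and the minus sign is their i^2.\<close>

lemma mom_identity:
  assumes w: "w \<in> V" and B: "set B \<subseteq> V" "length B \<le> 2"
  shows "mom J (w # B) * mom J [] - mom J B * mom J [w]
    = - (\<Sum>C\<in>{C. C \<subseteq> V \<and> w \<in> C}. mconst (cluster_weight J w B C)
        * restr (sites C) (mom (isolate J C) (filter (\<lambda>x. x \<notin> C) B) * mom (isolate J C) []))"
proof (rule mseries_eqI)
  fix A :: "nat set" assume A: "finite A"
  let ?s = "(-1 :: real) ^ ((card A + length B + 1) div 2)"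
  have sites: "A \<inter> sites C = {} \<longleftrightarrow> j ` A \<inter> C = {}" for C
    by (auto simp: sites_def)
  have "coef (mom J (w # B) * mom J [] - mom J B * mom J [w]) A
      = ?s * (convolve J (w # B) [] A - convolve J B [w] A)"
    using w B by (simp add: coef_mom_mult[OF A] right_diff_distrib)
  also have "\<dots> = (\<Sum>C\<in>{C. C \<subseteq> V \<and> w \<in> C}. cluster_weight J w B C * (?s
        * (if j ` A \<inter> C = {} then convolve (isolate J C) (filter (\<lambda>x. x \<notin> C) B) [] A else 0)))"
    by (simp only: two_replica_identity[OF w B(1) A] sum_distrib_left mult.left_commute)
  also have "\<dots> = (\<Sum>C\<in>{C. C \<subseteq> V \<and> w \<in> C}. cluster_weight J w B C * - coef (restr (sites C)
        (mom (isolate J C) (filter (\<lambda>x. x \<notin> C) B) * mom (isolate J C) [])) A)"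
  proof (rule sum.cong[OF refl])
    fix C
    show "cluster_weight J w B C * (?s
        * (if j ` A \<inter> C = {} then convolve (isolate J C) (filter (\<lambda>x. x \<notin> C) B) [] A else 0))
      = cluster_weight J w B C * - coef (restr (sites C)
        (mom (isolate J C) (filter (\<lambda>x. x \<notin> C) B) * mom (isolate J C) [])) A"
    proof (cases "even (length (filter (\<lambda>x. x \<in> C) B))")
      case True
      then show ?thesis using cluster_weight_even[OF w B(1)] by simp
    next
      case False
      \<comment> \<open>The bound on \<open>length B\<close> rules out three entries in
        \<open>C\<close>, which would give the opposite sign.\<close>
      then have "length (filter (\<lambda>x. x \<in> C) B) = 1"
        using B(2) length_filter_le[of "\<lambda>x. x \<in> C" B]
        by (cases "length (filter (\<lambda>x. x \<in> C) B)") (auto elim: oddE)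
      then have "length B = Suc (length (filter (\<lambda>x. x \<notin> C) B))"
        using length_filter_split[of B C] by simp
      then have "?s = - ((-1) ^ ((card A + length (filter (\<lambda>x. x \<notin> C) B)) div 2))"
        by simp
      moreover have "set (filter (\<lambda>x. x \<notin> C) B) \<subseteq> V" using B(1) by auto
      ultimately show ?thesis using A by (simp add: sites coef_mom_mult)
    qed
  qed
  finally show "coef (mom J (w # B) * mom J [] - mom J B * mom J [w]) A
    = coef (- (\<Sum>C\<in>{C. C \<subseteq> V \<and> w \<in> C}. mconst (cluster_weight J w B C)
        * restr (sites C) (mom (isolate J C) (filter (\<lambda>x. x \<notin> C) B) * mom (isolate J C) []))) A"
    by (simp only: coef_uminus coef_sum coef_mconst_mult sum_negf mult_minus_right)
qed

text \<open>As a ring homomorphism, restriction keeps \<open>mom J []\<close> invertible.\<close>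

lemma restr_mom_cancel:
  assumes "f * restr X (mom J []) = g * restr X (mom J [])"
  shows "f = g"
proof -
  have "restr X (mom J []) * restr X (minv (mom J [])) = 1"
    by (metis minv_mom mult.commute restr_1 restr_mult)
  then show ?thesis using assms by (metis mult.assoc mult.right_neutral)
qed

lemma restr_sum: "restr X (\<Sum>c\<in>Y. f c) = (\<Sum>c\<in>Y. restr X (f c))"
  by (rule mseries_eqI) simp

lemma restr_mconst: "restr X (mconst c) = mconst c"
  by (rule mseries_eqI) simp

text \<open>The quotient rule, cleared of denominators, from differentiating
  \<open>corr_mult\<close>.\<close>

lemma mderiv_corr_raw:
  "mderiv i (corr J B) * restr {i} (mom J []) * restr {i} (mom J [])
    = restr {i} (mom J (j i # B) * mom J [] - mom J B * mom J [j i])"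
proof -
  let ?r = "restr {i}"
  have "mderiv i (corr J B) * ?r (mom J []) + ?r (corr J B) * ?r (mom J [j i]) = ?r (mom J (j i # B))"
    using arg_cong[OF corr_mult[of J B], of "mderiv i"] by (simp add: mderiv_mult mderiv_mom)
  then have "mderiv i (corr J B) * ?r (mom J [])
      = ?r (mom J (j i # B)) - ?r (corr J B) * ?r (mom J [j i])"
    by (simp add: eq_diff_eq)
  then have "mderiv i (corr J B) * ?r (mom J []) * ?r (mom J [])
      = ?r (mom J (j i # B)) * ?r (mom J []) - ?r (corr J B) * ?r (mom J []) * ?r (mom J [j i])"
    by (simp only: left_diff_distrib right_diff_distrib mult_ac)
  then show ?thesis by (simp add: restr_diff corr_mult flip: restr_mult)
qed

text \<open>Dividing \<open>mom_identity\<close> by the squared partition function turns each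
  cluster term into a correlation off \<open>C\<close> times two factors \<open>vac\<close>.\<close>

theorem mderiv_corr:
  assumes B: "set B \<subseteq> V" "length B \<le> 2"
  shows "mderiv i (corr J B) = - (\<Sum>C\<in>{C. C \<subseteq> V \<and> j i \<in> C}. mconst (cluster_weight J (j i) B C)
    * restr {i} (restr (sites C) (corr (isolate J C) (filter (\<lambda>x. x \<notin> C) B)) * vac J C * vac J C))"
    (is "_ = - (\<Sum>C\<in>?Cs. ?k C * restr {i} (?X C))")
proof -
  let ?a = "mom J []" and ?r = "restr {i}"
  have term_eq: "restr (sites C) (mom (isolate J C) (filter (\<lambda>x. x \<notin> C) B) * mom (isolate J C) [])
      = ?X C * ?a * ?a" for C
  proof -
    have "restr (sites C) (mom (isolate J C) (filter (\<lambda>x. x \<notin> C) B) * mom (isolate J C) [])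
        = restr (sites C) (corr (isolate J C) (filter (\<lambda>x. x \<notin> C) B))
          * restr (sites C) (mom (isolate J C) []) * restr (sites C) (mom (isolate J C) [])"
      by (simp only: corr_mult flip: restr_mult)
    then show ?thesis by (simp only: mult_ac flip: vac_mult)
  qed
  have "mderiv i (corr J B) * ?r ?a * ?r ?a
      = ?r (- (\<Sum>C\<in>?Cs. ?k C * (?X C * ?a * ?a)))"
    unfolding mderiv_corr_raw mom_identity[OF j_in_V B] term_eq ..
  also have "\<dots> = (- (\<Sum>C\<in>?Cs. ?k C * ?r (?X C))) * ?r ?a * ?r ?a"
    by (simp only: restr_uminus restr_sum restr_mconst restr_mult
        mult_minus_left sum_distrib_right mult.assoc)
  finally show ?thesis by (rule restr_mom_cancel[THEN restr_mom_cancel])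
qed

text \<open>The numerator of \<open>vac\<close> contains no field on \<open>C\<close>, so the
  derivative falls on the denominator alone.\<close>

lemma mderiv_vac:
  assumes "j i \<in> C"
  shows "mderiv i (vac J C) = - restr {i} (vac J C * corr J [j i])"
proof -
  let ?a = "mom J []" and ?r = "restr {i}"
  have "mderiv i (vac J C * ?a) = 0"
    unfolding vac_mult using assms by (intro mseries_eqI) (auto simp: sites_def)
  then have "mderiv i (vac J C) * ?r ?a + ?r (vac J C) * ?r (mom J [j i]) = 0"
    by (simp add: mderiv_mult mderiv_mom)
  then have "mderiv i (vac J C) * ?r ?a = - ?r (vac J C) * ?r (corr J [j i]) * ?r ?a"
    by (simp add: corr_mult eq_neg_iff_add_eq_0 mult.assoc flip: restr_mult)
  then have "mderiv i (vac J C) = - ?r (vac J C) * ?r (corr J [j i])"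
    by (rule restr_mom_cancel)
  then show ?thesis by (simp add: restr_mult)
qed

section \<open>Removing edges from the partition function\<close>

lemma mom_cong: "(\<And>e. e \<in> E \<Longrightarrow> J e = J' e) \<Longrightarrow> mom J B = mom J' B"
  by (simp add: mom_def moment_def ising_weight_def)

text \<open>For x = 1 or x = -1, exp(s x) = cosh s + x sinh s; the minus sign is the i^2 of the two
  extra spins.\<close>

lemma mom_edge:
  assumes e: "{u, v} \<in> E"
  shows "mom J [] = mconst (cosh (J {u, v})) * mom (J({u, v} := 0)) []
    - mconst (sinh (J {u, v})) * mom (J({u, v} := 0)) [u, v]"
proof (rule mseries_eqI)
  fix A :: "nat set" assume A: "finite A"
  let ?s = "J {u, v}" and ?J0 = "J({u, v} := 0)"
  have uv: "u \<noteq> v" using edges[OF e] by auto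
  have weight: "ising_weight E J \<sigma> = (cosh ?s + sinh ?s * (\<sigma> u * \<sigma> v)) * ising_weight E ?J0 \<sigma>"
    if \<sigma>: "\<sigma> \<in> configs V" for \<sigma>
  proof -
    have "(\<Sum>e\<in>E. J e * (\<Prod>x\<in>e. \<sigma> x)) = ?s * (\<sigma> u * \<sigma> v) + (\<Sum>e\<in>E. ?J0 e * (\<Prod>x\<in>e. \<sigma> x))"
      using uv by (simp add: sum.remove[OF finite_E e])
    then have "ising_weight E J \<sigma> = exp (?s * (\<sigma> u * \<sigma> v)) * ising_weight E ?J0 \<sigma>"
      by (simp add: ising_weight_def exp_add)
    moreover have "exp (?s * (\<sigma> u * \<sigma> v)) = cosh ?s + sinh ?s * (\<sigma> u * \<sigma> v)"
      using configs_cases[OF \<sigma>, of u] configs_cases[OF \<sigma>, of v]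
      by (auto simp: cosh_plus_sinh cosh_minus_sinh)
    ultimately show ?thesis by simp
  qed
  have "moment J [] A = cosh ?s * moment ?J0 [] A + sinh ?s * moment ?J0 [u, v] A"
    unfolding moment_def sum_distrib_left sum.distrib[symmetric]
    by (intro sum.cong refl) (simp add: weight algebra_simps)
  then show "coef (mom J []) A
      = coef (mconst (cosh ?s) * mom ?J0 [] - mconst (sinh ?s) * mom ?J0 [u, v]) A"
    using A by (simp add: coef_mom algebra_simps)
qed

definition ferromagnetic :: "('v set \<Rightarrow> real) \<Rightarrow> bool" where
  "ferromagnetic J \<longleftrightarrow> (\<forall>e\<in>E. 0 \<le> J e)"

lemma ferromagnetic_isolate: "ferromagnetic J \<Longrightarrow> ferromagnetic (isolate J C)"
  by (simp add: ferromagnetic_def isolate_def)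

text \<open>The inverse ratio is cosh minus sinh times the two-point series without the edge, so its
  nonconstant coefficients are nonpositive and \<open>nonneg_upto_minv\<close> applies.\<close>

lemma nonneg_upto_remove_edge:
  assumes J: "ferromagnetic J" and e: "{u, v} \<in> E"
    and corr: "\<And>A. A \<noteq> {} \<Longrightarrow> card A \<le> d \<Longrightarrow> 0 \<le> coef (corr (J({u, v} := 0)) [u, v]) A"
  shows "nonneg_upto d (mom (J({u, v} := 0)) [] * minv (mom J []))"
proof -
  let ?s = "J {u, v}" and ?a = "mom (J({u, v} := 0)) []"
  define f where "f = mom J [] * minv ?a"
  have f: "f = mconst (cosh ?s) * 1 - mconst (sinh ?s) * corr (J({u, v} := 0)) [u, v]"
  proof -
    have inv: "?a * minv ?a = 1" by (subst mult.commute) (rule minv_mom)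
    show ?thesis
      by (simp only: f_def mom_edge[OF e, of J] corr_def left_diff_distrib mult.assoc inv)
  qed
  have "?s \<ge> 0" using J e by (simp add: ferromagnetic_def)
  then have "nonneg_upto d (minv f)"
  proof (intro nonneg_upto_minv)
    show "coef f {} > 0" using mom_pos by (simp add: f_def)
    show "coef f A \<le> 0" if "0 \<le> ?s" "A \<noteq> {}" "card A \<le> d" for A
      using corr[OF that(2,3)] that by (simp add: f)
  qed
  moreover have "minv f = ?a * minv (mom J [])"
  proof (rule minv_unique)
    have "?a * minv (mom J []) * f = (minv (mom J []) * mom J []) * (minv ?a * ?a)"
      by (simp add: f_def mult_ac)
    then show "?a * minv (mom J []) * f = 1" by (simp add: minv_mom)
  qed
  ultimately show ?thesis by simp
qed

text \<open>Edges are switched off one at a time and the ratios telescope. The couplings change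
  along the way, so \<open>corr\<close> is assumed for all ferromagnetic ones.\<close>

lemma nonneg_upto_remove_edges:
  assumes J: "ferromagnetic J" and X: "X \<subseteq> E"
    and corr: "\<And>J u v A. ferromagnetic J \<Longrightarrow> u \<in> V \<Longrightarrow> v \<in> V \<Longrightarrow> A \<noteq> {} \<Longrightarrow> card A \<le> d
      \<Longrightarrow> 0 \<le> coef (corr J [u, v]) A"
  shows "nonneg_upto d (mom (\<lambda>e. if e \<in> X then 0 else J e) [] * minv (mom J []))"
proof -
  have "finite X" using X finite_E by (rule finite_subset)
  then show ?thesis using X
  proof (induction X rule: finite_induct)
    case empty
    then show ?case using minv_mom[of J] by (simp add: mult.commute nonneg_upto_1)
  next
    case (insert e X)
    let ?J = "\<lambda>e. if e \<in> X then 0 else J e"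
    have "e \<in> E" using insert.prems by simp
    then obtain u v where uv: "e = {u, v}" "u \<noteq> v" "u \<in> V" "v \<in> V" by (rule edge_cases)
    have eE: "{u, v} \<in> E" using insert.prems uv by auto
    have eq: "(\<lambda>e'. if e' \<in> insert e X then 0 else J e') = ?J({u, v} := 0)"
      using uv by auto
    have ferro: "ferromagnetic ?J" "ferromagnetic (?J({u, v} := 0))"
      using J by (auto simp: ferromagnetic_def)
    have "nonneg_upto d (mom (?J({u, v} := 0)) [] * minv (mom ?J []))"
      using ferro uv by (intro nonneg_upto_remove_edge[OF _ eE] corr)
    moreover have "nonneg_upto d (mom ?J [] * minv (mom J []))"
      using insert by simp
    ultimately have "nonneg_upto d ((mom (?J({u, v} := 0)) [] * minv (mom ?J []))
        * (mom ?J [] * minv (mom J [])))"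
      by (rule nonneg_upto_mult)
    also have "(mom (?J({u, v} := 0)) [] * minv (mom ?J [])) * (mom ?J [] * minv (mom J []))
        = mom (?J({u, v} := 0)) [] * (minv (mom ?J []) * mom ?J []) * minv (mom J [])"
      by (simp only: mult.assoc)
    also have "\<dots> = mom (?J({u, v} := 0)) [] * minv (mom J [])"
      by (simp only: minv_mom mult_1_right)
    finally show ?case unfolding eq .
  qed
qed

section \<open>The simultaneous induction on the degree\<close>

text \<open>The constant coefficient of the two-point series is exempt: the sign convention makes it
  minus the zero-field correlation.\<close>

definition signs_upto :: "nat \<Rightarrow> bool" where
  "signs_upto d \<longleftrightarrow> (\<forall>J. ferromagnetic J \<longrightarrow>
    (\<forall>v\<in>V. nonneg_upto d (- corr J [v])) \<and>
    (\<forall>u\<in>V. \<forall>v\<in>V. \<forall>A. A \<noteq> {} \<longrightarrow> card A \<le> d \<longrightarrow> 0 \<le> coef (corr J [u, v]) A) \<and>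
    (\<forall>C. nonneg_upto d (vac J C)))"

lemma nonneg_uptoI:
  fixes f :: "'i mseries"
  assumes "0 \<le> coef f {}"
    and "\<And>i A. finite A \<Longrightarrow> i \<notin> A \<Longrightarrow> card (insert i A) \<le> d \<Longrightarrow> 0 \<le> coef f (insert i A)"
  shows "nonneg_upto d f"
  unfolding nonneg_upto_def
proof (intro allI impI)
  fix A :: "'i set" assume "card A \<le> d"
  moreover have "A = {} \<or> (\<exists>i A'. A = insert i A' \<and> i \<notin> A')"
    by (meson Set.set_insert ex_in_conv)
  ultimately show "0 \<le> coef f A"
    using assms by (cases "finite A") auto
qed

lemma filter_pair_odd:
  assumes "odd (length (filter (\<lambda>x. x \<in> C) [u, v]))"
  shows "filter (\<lambda>x. x \<notin> C) [u, v] = [u] \<or> filter (\<lambda>x. x \<notin> C) [u, v] = [v]"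
  using assms by (cases "u \<in> C"; cases "v \<in> C") auto

text \<open>At degree d + 1 the one- and two-point signs follow from field derivatives, which
  involve data up to degree d. The new two-point signs then help to give those of
  \<open>vac\<close>.\<close>

theorem signs: "signs_upto d"
proof (induction d)
  case 0
  show ?case
    unfolding signs_upto_def
  proof (intro allI impI conjI ballI)
    fix J :: "'v set \<Rightarrow> real" and v assume "v \<in> V"
    then show "nonneg_upto 0 (- corr J [v])"
      by (intro nonneg_uptoI) (auto simp: corr_def coef_mom moment_odd)
  next
    fix J :: "'v set \<Rightarrow> real" and C
    show "nonneg_upto 0 (vac J C)"
      using mom_pos[of J] mom_pos[of "isolate J C"] by (intro nonneg_uptoI) (auto simp: vac_def)
  next
    fix J :: "'v set \<Rightarrow> real" and u v and A :: "nat set"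
    assume "A \<noteq> {}" "card A \<le> 0"
    then show "0 \<le> coef (corr J [u, v]) A" by (cases "finite A") auto
  qed
next
  case (Suc d)
  have IH: "nonneg_upto d (- corr J [v])" "nonneg_upto d (vac J C)"
    if "ferromagnetic J" "v \<in> V" for J v C
    using Suc that unfolding signs_upto_def by blast+
  have weight: "0 \<le> cluster_weight J w B C" if "ferromagnetic J" for J w B C
    using that by (intro cluster_weight_nonneg) (simp add: ferromagnetic_def)
  have one: "nonneg_upto (Suc d) (- corr J [v])" if J: "ferromagnetic J" and v: "v \<in> V" for J v
  proof (rule nonneg_uptoI)
    show "0 \<le> coef (- corr J [v]) {}" using v by (simp add: corr_def coef_mom moment_odd)
    fix i and A :: "nat set" assume A: "finite A" "i \<notin> A" "card (insert i A) \<le> Suc d"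
    have "0 \<le> cluster_weight J (j i) [v] C * coef (restr {i} (restr (sites C)
        (corr (isolate J C) (filter (\<lambda>x. x \<notin> C) [v])) * vac J C * vac J C)) A" for C
    proof (cases "v \<in> C")
      \<comment> \<open>Filtering leaves the empty list, whose correlation is 1.\<close>
      case True
      then have "nonneg_upto d (restr (sites C) (corr (isolate J C) (filter (\<lambda>x. x \<notin> C) [v]))
          * vac J C * vac J C)"
        using IH[OF J v] by (simp add: nonneg_upto_mult)
      then show ?thesis using weight[OF J] A by (simp add: nonneg_upto_def)
    next
      case False
      then show ?thesis using v by (simp add: cluster_weight_even j_in_V)
    qed
    then have "0 \<le> - coef (mderiv i (corr J [v])) A"
      using v by (subst mderiv_corr) (auto intro: sum_nonneg)
    then show "0 \<le> coef (- corr J [v]) (insert i A)" using A by simp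
  qed
  have two: "0 \<le> coef (corr J [u, v]) A"
    if J: "ferromagnetic J" and uv: "u \<in> V" "v \<in> V" and A: "A \<noteq> {}" "card A \<le> Suc d" for J u v A
  proof (cases "finite A")
    case True
    obtain i A' where A': "A = insert i A'" "i \<notin> A'" using A(1) by (meson Set.set_insert ex_in_conv)
    have "0 \<le> cluster_weight J (j i) [u, v] C * - coef (restr {i} (restr (sites C)
        (corr (isolate J C) (filter (\<lambda>x. x \<notin> C) [u, v])) * vac J C * vac J C)) A'" for C
    proof (cases "even (length (filter (\<lambda>x. x \<in> C) [u, v]))")
      case True
      then show ?thesis using uv cluster_weight_even[OF j_in_V _ True] by simp
    next
      case False
      \<comment> \<open>Exactly one of the two spins stays outside \<open>C\<close>; its nonpositive
        series cancels the minus sign of \<open>mderiv_corr\<close>.\<close>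
      then obtain x where x: "x \<in> V" "filter (\<lambda>x. x \<notin> C) [u, v] = [x]"
        using filter_pair_odd[OF False] uv by blast
      have "nonneg_upto d (restr (sites C) (- corr (isolate J C) [x]) * vac J C * vac J C)"
        using IH[OF J x(1)] IH[OF ferromagnetic_isolate[OF J] x(1)]
        by (intro nonneg_upto_mult nonneg_upto_restr)
      then have "0 \<le> - coef (restr {i} (restr (sites C) (corr (isolate J C) [x]) * vac J C * vac J C)) A'"
        using A A' True by (simp add: nonneg_upto_def restr_uminus)
      then show ?thesis unfolding x(2) using weight[OF J] by (rule mult_nonneg_nonneg[rotated])
    qed
    then have "0 \<le> (\<Sum>C\<in>{C. C \<subseteq> V \<and> j i \<in> C}. cluster_weight J (j i) [u, v] C * - coef (restr {i}
        (restr (sites C) (corr (isolate J C) (filter (\<lambda>x. x \<notin> C) [u, v])) * vac J C * vac J C)) A')"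
      by (rule sum_nonneg)
    also have "\<dots> = coef (mderiv i (corr J [u, v])) A'"
      using uv by (subst mderiv_corr) (simp_all only: coef_uminus coef_sum coef_mconst_mult
          mult_minus_right sum_negf, auto)
    finally show ?thesis using A' by simp
  qed simp
  have three: "nonneg_upto (Suc d) (vac J C)" if J: "ferromagnetic J" for J C
    unfolding nonneg_upto_def
  proof (intro allI impI)
    fix A :: "nat set" assume A: "card A \<le> Suc d"
    \<comment> \<open>A coefficient with a field on \<open>C\<close> is reached through
      \<open>mderiv_vac\<close>. Without such a field, restriction leaves the coefficient unchanged
      and edge removal applies.\<close>
    consider "infinite A" | i where "finite A" "i \<in> A" "j i \<in> C"
      | "finite A" "A \<inter> sites C = {}"
      by (auto simp: sites_def)
    then show "0 \<le> coef (vac J C) A"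
    proof cases
      case 2
      then obtain A' where A': "A = insert i A'" "i \<notin> A'" by (meson Set.set_insert)
      have "nonneg_upto d (vac J C * - corr J [j i])"
        using IH[OF J j_in_V] by (intro nonneg_upto_mult)
      then have "0 \<le> coef (mderiv i (vac J C)) A'"
        using 2 A A' by (simp add: mderiv_vac nonneg_upto_def)
      then show ?thesis using A' by simp
    next
      case 3
      define X where "X = {e \<in> E. e \<inter> C \<noteq> {}}"
      have "mom (isolate J C) [] = mom (\<lambda>e. if e \<in> X then 0 else J e) []"
        by (rule mom_cong) (auto simp: X_def isolate_def)
      then have "nonneg_upto (Suc d) (mom (isolate J C) [] * minv (mom J []))"
        using nonneg_upto_remove_edges[OF J, of X "Suc d"] two by (auto simp: X_def)
      moreover have "coef (vac J C) A = coef (mom (isolate J C) [] * minv (mom J [])) A"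
        unfolding vac_def coef_mult[OF 3(1)] using 3(2) by (intro sum.cong refl) auto
      ultimately show ?thesis using A by (simp add: nonneg_upto_def)
    qed simp
  qed
  show ?case unfolding signs_upto_def using one two three by blast
qed

end

section \<open>Ursell functions\<close>

text \<open>For \<open>m {} = 1\<close> and nonempty \<open>A\<close>, this is the coefficient at
  \<open>A\<close> of the logarithm of the series \<open>m\<close>. General index sets permit a
  recursion over subsets.\<close>

definition cumulant :: "('i set \<Rightarrow> real) \<Rightarrow> 'i set \<Rightarrow> real" where
  "cumulant m A = (\<Sum>P\<in>{P. partition_on A P}.
    (-1) ^ (card P - 1) * fact (card P - 1) * (\<Prod>B\<in>P. m B))"

lemma partition_on_remove:
  assumes "partition_on X Q" "T \<in> Q"
  shows "partition_on (X - T) (Q - {T})" "T \<subseteq> X" "T \<noteq> {}"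
proof -
  have "disjnt T (\<Union>(Q - {T}))"
    using assms by (auto simp: partition_on_def disjnt_def pairwise_def)
  moreover have "insert T (Q - {T}) = Q" using assms(2) by auto
  ultimately have "partition_on (X - T) (Q - {T}) \<and> T \<subseteq> X \<and> T \<noteq> {}"
    using assms(1) partition_on_insert[of T "Q - {T}" X] by metis
  then show "partition_on (X - T) (Q - {T})" "T \<subseteq> X" "T \<noteq> {}" by auto
qed

lemma card_blocks_avoiding:
  assumes "finite X" "partition_on X Q" "i \<in> X"
  shows "card {T \<in> Q. i \<notin> T} = card Q - 1" "card Q \<ge> 1"
proof -
  obtain U where U: "U \<in> Q" "i \<in> U" using assms(2,3) partition_onD1 by blast
  have uniq: "i \<in> T \<longleftrightarrow> T = U" if "T \<in> Q" for T
    using that U disjointD[OF partition_onD2[OF assms(2)] that U(1)] by auto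
  have "{T \<in> Q. i \<notin> T} = Q - {U}"
    by (rule set_eqI) (simp add: uniq cong: conj_cong)
  moreover have "finite Q" by (rule finite_elements[OF assms(1,2)])
  ultimately show "card {T \<in> Q. i \<notin> T} = card Q - 1" "card Q \<ge> 1"
    using U by (auto simp: Suc_le_eq card_gt_0_iff)
qed

lemma partition_on_card_1:
  assumes "partition_on X Q" "card Q = 1"
  shows "Q = {X}"
proof -
  obtain B where "Q = {B}" using assms(2) by (auto simp: card_1_singleton_iff)
  then show ?thesis using partition_onD1[OF assms(1)] by simp
qed

text \<open>The blocks of a partition of \<open>insert i A\<close> that avoid i can each be split off;
  over all partitions with at least two blocks the two contributions cancel.\<close>

lemma moment_cumulant:
  assumes A: "finite A" and i: "i \<notin> A" and m: "m {} = 1"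
  shows "m (insert i A) = (\<Sum>S\<in>Pow A. cumulant m (insert i S) * m (A - S))"
proof -
  let ?X = "insert i A" and ?c = "\<lambda>n. (-1 :: real) ^ (n - 1) * fact (n - 1)"
  let ?Qs = "{Q. partition_on ?X Q}" and ?I = "Sigma (Pow A - {A}) (\<lambda>S. {P. partition_on (insert i S) P})"
  let ?T = "\<lambda>Q. {T \<in> Q. i \<notin> T}"
  have finQs: "finite ?Qs" using A by (simp add: finitely_many_partition_on)
  have finP: "finite {P. partition_on (insert i S) P}" if "S \<subseteq> A" for S
    using finite_subset[OF that A] by (simp add: finitely_many_partition_on)
  have finQ: "finite Q" if "Q \<in> ?Qs" for Q
    using that A finite_elements[of ?X Q] by simp
  have "(\<Sum>S\<in>Pow A - {A}. cumulant m (insert i S) * m (A - S))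
      = (\<Sum>(S, P)\<in>?I. ?c (card P) * (\<Prod>B\<in>P. m B) * m (A - S))"
    unfolding cumulant_def sum_distrib_right
    using A finP by (subst sum.Sigma) auto
  \<comment> \<open>Adding the block \<open>A - S\<close> to \<open>P\<close> gives a partition
    \<open>Q\<close> of the whole set with a marked block avoiding \<open>i\<close>.\<close>
  also have "\<dots> = (\<Sum>(Q, T)\<in>Sigma ?Qs ?T. ?c (card Q - 1) * (\<Prod>B\<in>Q. m B))"
  proof (rule sum.reindex_bij_witness[of _ "\<lambda>(Q, T). (A - T, Q - {T})"
        "\<lambda>(S, P). (insert (A - S) P, A - S)"], goal_cases)
    case (1 p)
    then obtain S P where p: "p = (S, P)" "S \<subseteq> A" "S \<noteq> A" "partition_on (insert i S) P" by auto
    have "A - S \<notin> P"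
    proof
      assume "A - S \<in> P"
      then have "A - S \<subseteq> insert i S" using partition_onD1[OF p(4)] by auto
      then show False using p(2,3) i by auto
    qed
    then show ?case using p(1,2) by (simp add: double_diff)
  next
    case (2 p)
    then obtain S P where p: "p = (S, P)" "S \<subseteq> A" "S \<noteq> A" "partition_on (insert i S) P" by auto
    have "disjnt (A - S) (\<Union>P)"
      using i unfolding partition_onD1[OF p(4), symmetric] by (auto simp: disjnt_def)
    moreover have "?X - (A - S) = insert i S" using i p(2) by auto
    ultimately have "partition_on ?X (insert (A - S) P)"
      using p(2-4) by (subst partition_on_insert) auto
    then show ?case using p(1) i by auto
  next
    case (3 p)
    then obtain Q T where p: "p = (Q, T)" "partition_on ?X Q" "T \<in> Q" "i \<notin> T" by auto
    have "A - (A - T) = T" using partition_on_remove(2)[OF p(2,3)] p(4) by auto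
    then show ?case using p(1,3) by (simp add: insert_absorb)
  next
    case (4 p)
    then obtain Q T where p: "p = (Q, T)" "partition_on ?X Q" "T \<in> Q" "i \<notin> T" by auto
    note rem = partition_on_remove[OF p(2,3)]
    have "?X - T = insert i (A - T)" using p(4) by auto
    moreover have "A - T \<noteq> A" using rem(2,3) p(4) by auto
    ultimately show ?case using p(1) rem(1) by auto
  next
    case (5 p)
    then obtain S P where p: "p = (S, P)" "S \<subseteq> A" "S \<noteq> A" "partition_on (insert i S) P" by auto
    have "A - S \<notin> P"
    proof
      assume "A - S \<in> P"
      then have "A - S \<subseteq> insert i S" using partition_onD1[OF p(4)] by auto
      then show False using p(2,3) i by auto
    qed
    moreover have "finite P"
      using p(2,4) A by (meson finite.insertI finite_elements finite_subset)
    ultimately show ?case using p(1) by simp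
  qed
  also have "\<dots> = (\<Sum>Q\<in>?Qs. \<Sum>T\<in>?T Q. ?c (card Q - 1) * (\<Prod>B\<in>Q. m B))"
    using finQs finQ by (subst sum.Sigma) auto
  \<comment> \<open>Exactly one block of \<open>Q\<close> contains \<open>i\<close>, which leaves
    \<open>card Q - 1\<close> choices for the marked block.\<close>
  also have "\<dots> = (\<Sum>Q\<in>?Qs. real (card Q - 1) * (?c (card Q - 1) * (\<Prod>B\<in>Q. m B)))"
    using card_blocks_avoiding(1)[of ?X _ i] A by (intro sum.cong) auto
  finally have split: "(\<Sum>S\<in>Pow A - {A}. cumulant m (insert i S) * m (A - S))
      = (\<Sum>Q\<in>?Qs. real (card Q - 1) * (?c (card Q - 1) * (\<Prod>B\<in>Q. m B)))" .
  have "(\<Sum>S\<in>Pow A. cumulant m (insert i S) * m (A - S))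
      = cumulant m ?X + (\<Sum>S\<in>Pow A - {A}. cumulant m (insert i S) * m (A - S))"
    using A m by (subst sum.remove[of _ A]) auto
  also have "\<dots> = (\<Sum>Q\<in>?Qs. (?c (card Q) + real (card Q - 1) * ?c (card Q - 1)) * (\<Prod>B\<in>Q. m B))"
    unfolding split by (simp add: cumulant_def distrib_right mult.assoc flip: sum.distrib)
  \<comment> \<open>Since c(n) = -(n - 1) c(n - 1) for n at least 2, the one-block partition alone
    survives.\<close>
  also have "\<dots> = (\<Sum>Q\<in>?Qs. if Q = {?X} then m ?X else 0)"
  proof (rule sum.cong[OF refl])
    fix Q assume Q: "Q \<in> ?Qs"
    then have "card Q \<ge> 1" using card_blocks_avoiding(2)[of ?X Q i] A by auto
    then consider "card Q = 1" | "card Q = Suc (Suc (card Q - 2))" by linarith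
    then show "(?c (card Q) + real (card Q - 1) * ?c (card Q - 1)) * (\<Prod>B\<in>Q. m B)
        = (if Q = {?X} then m ?X else 0)"
    proof cases
      case 1
      then have "Q = {?X}" using partition_on_card_1[of ?X Q] Q by simp
      then show ?thesis by simp
    next
      case 2
      then obtain n where n: "card Q = Suc (Suc n)" by blast
      then have "Q \<noteq> {?X}" by auto
      then show ?thesis using n by simp
    qed
  qed
  also have "\<dots> = m ?X"
    using finQs partition_on_space[of ?X] by (simp add: sum.delta)
  finally show ?thesis by simp
qed

section \<open>Differentiation with respect to a coupling\<close>

lemma has_field_derivative_coef_mult:
  assumes "\<And>A. ((\<lambda>s. coef (f s) A) has_field_derivative coef f' A) (at t)"
    and "\<And>A. ((\<lambda>s. coef (g s) A) has_field_derivative coef g' A) (at t)"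
  shows "((\<lambda>s. coef (f s * g s) A) has_field_derivative coef (f' * g t + f t * g') A) (at t)"
proof (cases "finite A")
  case True
  have "((\<lambda>s. \<Sum>S\<in>Pow A. coef (f s) S * coef (g s) (A - S)) has_field_derivative
      (\<Sum>S\<in>Pow A. coef f' S * coef (g t) (A - S) + coef (f t) S * coef g' (A - S))) (at t)"
    by (intro DERIV_sum, rule DERIV_cong[OF DERIV_mult[OF assms]]) simp
  then show ?thesis
    by (simp add: coef_mult[OF True] sum.distrib)
qed simp

text \<open>By the recursion, each coefficient is a rational function of those of \<open>f\<close>.
  Differentiability suffices, as the derivative of a quotient is later read off from a
  product.\<close>

lemma differentiable_coef_minv:
  assumes f: "\<And>A. (\<lambda>s. coef (f s) A) field_differentiable (at t)"
    and nz: "coef (f t) {} \<noteq> 0"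
  shows "(\<lambda>s. coef (minv (f s)) A) field_differentiable (at t)"
proof (cases "finite A")
  case True
  then show ?thesis
  proof (induction A rule: finite_psubset_induct)
    case (psubset A)
    show ?case
    proof (cases "A = {}")
      case True
      then show ?thesis using f nz by (auto intro!: field_differentiable_divide)
    next
      case False
      have "(\<lambda>s. - (\<Sum>S\<in>Pow A - {A}. coef (minv (f s)) S * coef (f s) (A - S)) / coef (f s) {})
          field_differentiable (at t)"
        by (intro field_differentiable_divide field_differentiable_minus field_differentiable_sum
            field_differentiable_mult f nz psubset.IH) auto
      then show ?thesis by (simp add: minv_rec[OF psubset.hyps False])
    qed
  qed
qed simp

context ising_graph
begin

lemma ising_expect_eq:
  "ising_expect V E J (\<lambda>\<sigma>. \<Prod>i\<in>B. \<sigma> (j i)) = moment J [] B / moment J [] {}"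
  by (simp add: ising_expect_def partition_fn_def moment_def)

lemma ursell_eq_cumulant:
  "ursell V E J n j = cumulant (\<lambda>B. moment J [] B / moment J [] {}) {1..n}"
  by (simp add: ursell_def cumulant_def ising_expect_eq)

text \<open>Cumulants are the coefficients of log Z, whose field derivative at \<open>i\<close> is
  the one-point function. Concretely, \<open>moment_cumulant\<close> makes \<open>u\<close> times
  the partition function equal to \<open>mom J [j i]\<close>, both with the field \<open>i\<close>
  off.\<close>

lemma cumulant_eq_corr:
  assumes A: "finite A" "i \<notin> A"
  shows "cumulant (\<lambda>B. moment J [] B / moment J [] {}) (insert i A)
    = (-1) ^ ((card A + 1) div 2) * coef (corr J [j i]) A"
proof -
  let ?m = "\<lambda>B. moment J [] B / moment J [] {}" and ?r = "restr {i}"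
  define u where "u = mseries (\<lambda>A. if i \<in> A then 0
    else (-1) ^ ((card A + 1) div 2) * cumulant ?m (insert i A))"
  have z: "moment J [] {} \<noteq> 0" using moment_pos[of J] by simp
  have "u * ?r (mom J []) = ?r (corr J [j i]) * ?r (mom J [])"
    unfolding restr_mult[symmetric] corr_mult
  proof (rule mseries_eqI)
    fix A :: "nat set" assume A: "finite A"
    show "coef (u * ?r (mom J [])) A = coef (?r (mom J [j i])) A"
    proof (cases "i \<in> A")
      case True
      then have "coef u S * coef (?r (mom J [])) (A - S) = 0" if "S \<in> Pow A" for S
        by (simp add: u_def)
      then show ?thesis using True unfolding coef_mult[OF A] by (simp add: sum.neutral)
    next
      case False
      have "coef u S * coef (?r (mom J [])) (A - S) = (-1) ^ ((card A + 1) div 2)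
          * (moment J [] {} * (cumulant ?m (insert i S) * ?m (A - S)))" if S: "S \<in> Pow A" for S
      proof (cases "even (card (A - S))")
        case True
        have fin: "finite S" "finite (A - S)" using S A finite_subset by auto
        have card: "card A = card S + card (A - S)"
          using S A card_Diff_subset[OF fin(1), of A] card_mono[of A S] by simp
        obtain b where b: "card (A - S) = 2 * b" using True by (metis evenE)
        have "card A + 1 = (card S + 1) + 2 * b" using b card by simp
        then have "(card A + 1) div 2 = (card S + 1) div 2 + b"
          by (metis div_mult_self4 add.commute numeral_eq_one_iff zero_neq_numeral)
        moreover have "i \<notin> S" "i \<notin> A - S" using False S by auto
        ultimately show ?thesis using fin b z by (simp add: u_def coef_mom power_add)
      next
        case False
        then show ?thesis using A moment_odd[of "[]" "A - S" J] by (simp add: coef_mom)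
      qed
      then have "coef (u * ?r (mom J [])) A = (-1) ^ ((card A + 1) div 2)
          * (moment J [] {} * (\<Sum>S\<in>Pow A. cumulant ?m (insert i S) * ?m (A - S)))"
        unfolding coef_mult[OF A] sum_distrib_left by (intro sum.cong refl)
      also have "(\<Sum>S\<in>Pow A. cumulant ?m (insert i S) * ?m (A - S)) = ?m (insert i A)"
        using A False z by (intro moment_cumulant[symmetric]) auto
      finally show ?thesis using A False z by (simp add: coef_mom moment_insert)
    qed
  qed
  then have "u = ?r (corr J [j i])" by (rule restr_mom_cancel)
  then have "coef u A = coef (?r (corr J [j i])) A" by simp
  then have "(-1) ^ ((card A + 1) div 2) * cumulant ?m (insert i A) = coef (corr J [j i]) A"
    using A by (simp add: u_def)
  then show ?thesis by (cases "even ((card A + 1) div 2)") auto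
qed

lemma has_field_derivative_moment:
  assumes e: "{u, v} \<in> E"
  shows "((\<lambda>s. moment (J({u, v} := s)) B A) has_field_derivative
    moment (J({u, v} := t)) (u # v # B) A) (at t)"
proof -
  have uv: "u \<noteq> v" using edges[OF e] by auto
  have weight: "((\<lambda>s. ising_weight E (J({u, v} := s)) \<sigma>) has_field_derivative
      \<sigma> u * \<sigma> v * ising_weight E (J({u, v} := t)) \<sigma>) (at t)" for \<sigma>
  proof -
    have "ising_weight E (J({u, v} := s)) \<sigma>
        = exp (s * (\<sigma> u * \<sigma> v) + (\<Sum>e\<in>E - {{u, v}}. J e * (\<Prod>x\<in>e. \<sigma> x)))" for s
      unfolding ising_weight_def using uv by (simp add: sum.remove[OF finite_E e])
    then show ?thesis by (auto intro!: derivative_eq_intros)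
  qed
  show ?thesis unfolding moment_def
    by (rule DERIV_cong[OF DERIV_sum[OF DERIV_cmult[OF weight]]]) (simp add: mult_ac)
qed

text \<open>The two spins brought down raise the sign exponent by one, hence the minus.\<close>

lemma has_field_derivative_mom:
  assumes e: "{u, v} \<in> E"
  shows "((\<lambda>s. coef (mom (J({u, v} := s)) B) A) has_field_derivative
    coef (- mom (J({u, v} := t)) (u # v # B)) A) (at t)"
proof (cases "finite A")
  case True
  then show ?thesis
    using DERIV_cmult[OF has_field_derivative_moment[OF e, of J B A t],
        of "(-1) ^ ((card A + length B) div 2)"]
    by (simp add: coef_mom)
qed simp

lemma mom_rotate: "mom J [u, v, w] = mom J [w, u, v]"
  by (simp add: mom_def moment_def mult_ac)

text \<open>Up to sign, the coupling derivative of the one-point function and the field derivative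
  of the two-point function are the same truncated correlation of \<open>\<sigma> (j i)\<close> with
  the edge product.\<close>

lemma has_field_derivative_corr:
  assumes e: "{u, v} \<in> E" and i: "i \<notin> A"
  shows "((\<lambda>s. coef (corr (J({u, v} := s)) [j i]) A) has_field_derivative
    - coef (corr (J({u, v} := t)) [u, v]) (insert i A)) (at t)"
proof -
  let ?J = "\<lambda>s. J({u, v} := s)" and ?r = "restr {i}"
  define D where "D = mseries (\<lambda>A. deriv (\<lambda>s. coef (corr (?J s) [j i]) A) t)"
  have mom: "(\<lambda>s. coef (mom (?J s) B) A) field_differentiable (at t)" for B A
    using has_field_derivative_mom[OF e] unfolding field_differentiable_def by blast
  have "(\<lambda>s. coef (corr (?J s) [j i]) A) field_differentiable (at t)" for A
  proof (cases "finite A")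
    case True
    then show ?thesis unfolding corr_def coef_mult[OF True]
      using mom_pos[of "?J t"]
      by (intro field_differentiable_sum field_differentiable_mult mom differentiable_coef_minv) auto
  qed simp
  then have D: "((\<lambda>s. coef (corr (?J s) [j i]) A) has_field_derivative coef D A) (at t)" for A
    by (cases "finite A") (auto simp: D_def field_differentiable_derivI)
  \<comment> \<open>The value of \<open>D\<close> comes from differentiating
    \<open>corr_mult\<close> and uniqueness of derivatives.\<close>
  have "D * mom (?J t) [] + corr (?J t) [j i] * - mom (?J t) [u, v] = - mom (?J t) [u, v, j i]"
  proof (rule mseries_eqI)
    fix A :: "nat set"
    have "((\<lambda>s. coef (corr (?J s) [j i] * mom (?J s) []) A) has_field_derivative
        coef (D * mom (?J t) [] + corr (?J t) [j i] * - mom (?J t) [u, v]) A) (at t)"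
      by (rule has_field_derivative_coef_mult[OF D has_field_derivative_mom[OF e]])
    then show "coef (D * mom (?J t) [] + corr (?J t) [j i] * - mom (?J t) [u, v]) A
        = coef (- mom (?J t) [u, v, j i]) A"
      unfolding corr_mult by (rule DERIV_unique[OF _ has_field_derivative_mom[OF e]])
  qed
  then have "D * mom (?J t) [] = - mom (?J t) [u, v, j i] - corr (?J t) [j i] * - mom (?J t) [u, v]"
    by (simp only: eq_diff_eq)
  also have "\<dots> = corr (?J t) [j i] * mom (?J t) [u, v] - mom (?J t) [u, v, j i]"
    by simp
  finally have "D * mom (?J t) [] * mom (?J t) []
      = (corr (?J t) [j i] * mom (?J t) []) * mom (?J t) [u, v] - mom (?J t) [u, v, j i] * mom (?J t) []"
    by (simp only: left_diff_distrib right_diff_distrib mult_ac)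
  also have "\<dots> = - (mom (?J t) [j i, u, v] * mom (?J t) [] - mom (?J t) [u, v] * mom (?J t) [j i])"
    unfolding corr_mult mom_rotate by (simp add: mult.commute)
  finally have "?r (D * mom (?J t) [] * mom (?J t) [])
      = - (mderiv i (corr (?J t) [u, v]) * ?r (mom (?J t) []) * ?r (mom (?J t) []))"
    unfolding mderiv_corr_raw by (simp only: restr_uminus)
  then have "?r D * ?r (mom (?J t) []) * ?r (mom (?J t) [])
      = - mderiv i (corr (?J t) [u, v]) * ?r (mom (?J t) []) * ?r (mom (?J t) [])"
    by (simp add: restr_mult)
  then have "?r D = - mderiv i (corr (?J t) [u, v])"
    by (rule restr_mom_cancel[THEN restr_mom_cancel])
  then have "coef (?r D) A = coef (- mderiv i (corr (?J t) [u, v])) A" by simp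
  then have "coef D A = - coef (corr (?J t) [u, v]) (insert i A)"
    using i by simp
  then show ?thesis using D[of A] by simp
qed

theorem ursell_monotone:
  assumes k: "k \<ge> 1" and J: "ferromagnetic J" and e: "{u, v} \<in> E"
  shows "(\<lambda>t. ursell V E (J({u, v} := t)) (2 * k) j) differentiable (at (J {u, v}))
    \<and> (-1) ^ (k - 1) * deriv (\<lambda>t. ursell V E (J({u, v} := t)) (2 * k) j) (J {u, v}) \<ge> 0"
proof -
  let ?A = "{1..<2 * k}" and ?c = "coef (corr J [u, v]) (insert (2 * k) {1..<2 * k})"
  \<comment> \<open>The last index becomes the distinguished one; the other \<open>2 * k - 1\<close>
    select the coefficient.\<close>
  have set_eq: "{1..2 * k} = insert (2 * k) ?A" using k by auto
  have sign: "(card ?A + 1) div 2 = k" using k by simp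
  have ursell: "ursell V E J' (2 * k) j = (-1) ^ k * coef (corr J' [j (2 * k)]) ?A" for J'
    unfolding ursell_eq_cumulant set_eq by (subst cumulant_eq_corr) (simp, simp, simp only: sign)
  have deriv: "((\<lambda>t. ursell V E (J({u, v} := t)) (2 * k) j) has_field_derivative
      (-1) ^ k * - ?c) (at (J {u, v}))"
    unfolding ursell
    using has_field_derivative_corr[OF e, of "2 * k" ?A J "J {u, v}"] by (intro DERIV_cmult) simp
  have "u \<in> V" "v \<in> V" using edges[OF e] by auto
  then have "0 \<le> ?c"
    using signs[of "2 * k"] J k by (auto simp: signs_upto_def)
  moreover have "(-1 :: real) ^ (k - 1) * ((-1) ^ k * - ?c) = ?c"
    using k by (cases k) (simp_all flip: power_add mult.assoc)
  ultimately show ?thesis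
    using deriv DERIV_imp_deriv[OF deriv]
    by (auto simp: differentiable_def has_field_derivative_def)
qed

end

text \<open>This allows \<open>j\<close> to be replaced by a total map into \<open>V\<close>, as the
  locale demands.\<close>

lemma ursell_cong:
  assumes "\<And>i. i \<in> {1..n} \<Longrightarrow> j i = j' i"
  shows "ursell V E J n j = ursell V E J n j'"
  unfolding ursell_def
proof (intro sum.cong refl arg_cong2[where f = "(*)"] prod.cong)
  fix P B assume "P \<in> {P. partition_on {1..n} P}" "B \<in> P"
  then have "B \<subseteq> {1..n}" using partition_onD1 by blast
  then have "(\<Prod>i\<in>B. \<sigma> (j i)) = (\<Prod>i\<in>B. \<sigma> (j' i))" for \<sigma> :: "'a \<Rightarrow> real"
    using assms by (intro prod.cong) auto
  then show "ising_expect V E J (\<lambda>\<sigma>. \<Prod>i\<in>B. \<sigma> (j i)) = ising_expect V E J (\<lambda>\<sigma>. \<Prod>i\<in>B. \<sigma> (j' i))"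
    by simp
qed

theorem mainTheorem1:
  fixes V :: "'v set" and E :: "'v set set" and J :: "'v set \<Rightarrow> real"
    and k :: nat and j :: "nat \<Rightarrow> 'v" and u0 v0 :: 'v
  assumes "finite V"
    and "\<forall>e\<in>E. e \<subseteq> V \<and> card e = 2"
    and "\<forall>e\<in>E. J e \<ge> 0"
    and "k \<ge> 1"
    and "\<forall>i\<in>{1..2*k}. j i \<in> V"
    and "{u0, v0} \<in> E"
  shows "(\<lambda>t. ursell V E (J({u0, v0} := t)) (2*k) j) differentiable (at (J {u0, v0}))
    \<and> (-1) ^ (k - 1) * deriv (\<lambda>t. ursell V E (J({u0, v0} := t)) (2*k) j) (J {u0, v0}) \<ge> 0"
proof -
  \<comment> \<open>Beyond the index range, \<open>u0\<close> serves as some vertex of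
    \<open>V\<close>.\<close>
  define j' where "j' i = (if i \<in> {1..2*k} then j i else u0)" for i
  have "u0 \<in> V" using assms(2,6) by auto
  then interpret ising_graph V E j'
    using assms(1,2,5) by unfold_locales (auto simp: j'_def)
  have "ursell V E J' (2*k) j = ursell V E J' (2*k) j'" for J'
    by (rule ursell_cong) (simp add: j'_def)
  moreover have "ferromagnetic J" using assms(3) by (simp add: ferromagnetic_def)
  ultimately show ?thesis using ursell_monotone[OF assms(4) _ assms(6)] by simp
qed

end
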